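(* Let $N=N_1\circ N_2$ be a feedforward coalescence network with coalescence cell $c$, where $N_1,N_2$ have $n_1,n_2$ cells, and let $F^N,F^{N_1},F^{N_2}$ be the diffusive admissible systems of $N,N_1,N_2$ defined by the same smooth pair $(g,h)$, with the origin an equilibrium for every $\lambda$. (a) Suppose a bifurcation condition for $F^N$ holds which is a bifurcation condition for $F^{N_1}$ but not for $F^{N_2}$. Then each bifurcation branch of $F^{N_1}$ corresponds to a unique bifurcation branch of $F^N$, and vice versa: for each bifurcation branch $(b_1,b_c)$ of $F^{N_1}$ there is a unique $b_2$ (with values in $\mathbb{R}^{n_2-1}$) such that $(b_1,b_c,b_2)$ is a bifurcation branch of $F^N$; and for each bifurcation branch $(b_1,b_c,b_2)$ of $F^N$, the pair $(b_1,b_c)$ is a bifurcation branch of $F^{N_1}$. (b) Suppose a bifurcation condition for $F^N$ holds which is a bifurcation condition for $F^{N_2}$ but not for $F^{N_1}$. Then each bifurcation branch of $F^{N_2}$ corresponds to a unique bifurcation branch of $F^N$, and vice versa: for each bifurcation branch $(b_c,b_2)$ of $F^{N_2}$ there is a unique $b_1$ (with values in $\mathbb{R}^{n_1-1}$) such that $(b_1,b_c,b_2)$ is a bifurcation branch of $F^N$; and for each bifurcation branch $(b_1,b_c,b_2)$ of $F^N$, the pair $(b_c,b_2)$ is a bifurcation branch of $F^{N_2}$.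
   Context: A (weighted, uniform) network $N$ with $n$ cells consists of a finite set $C$ of cells and a real weighted adjacency matrix $W_N=(w_{ij})$, where $w_{ij}$ is the weight of the edge from cell $j$ to cell $i$ ($0$ if there is no edge; self-loops $w_{ii}$ are allowed). Networks are assumed connected as undirected graphs. The input valency of cell $i$ is $v(i)=\sum_j w_{ij}$, $D_N$ is the diagonal matrix of input valencies, and the Laplacian is $L_N=D_N-W_N$. Coalescence: $N=N_1\circ N_2$ has cell set $C=C_1\cup C_2$ with $C_1\cap C_2=\{c\}$, and weights $w^N_{cc}=w^{N_1}_{cc}+w^{N_2}_{cc}$; $w^N_{ab}=w^{N_i}_{ab}$ if $a,b\in C_i$ and $(a,b)\ne(c,c)$; all other weights are $0$. Cells are ordered so that $c$ is the last cell of $N_1$ and the first cell of $N_2$; states of $N$ are written $(x_1,x_c,x_2)\in\mathbb{R}^{n_1-1}\times\mathbb{R}\times\mathbb{R}^{n_2-1}$. $N$ is a feedforward coalescence network (FFCN) if, in $N_2$, the cell $c$ receives no input edge from the other cells of $N_2$ (a self-loop at $c$ is allowed). Given smooth $g:\mathbb{R}\times\mathbb{R}\to\mathbb{R}$ and $h:\mathbb{R}\times\mathbb{R}\times\mathbb{R}\to\mathbb{R}$, the admissible system $F^N:\mathbb{R}^n\times\mathbb{R}\to\mathbb{R}^n$ of a network $N$ has components $f_i(x,\lambda)=g(x_i,\lambda)+\sum_jw_{ij}h(x_i,x_j,\lambda)$. It is diffusive if $h(z,z,\lambda)=0$ for all $z,\lambda$. With $g_0=\partial_xg(0,0)$ and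 $h_1=\partial_{x_1}h(0,0,0)$ (derivative in the first argument), the Jacobian at $x=0$, $\lambda=0$ is then $J^N=g_0\,\mathrm{id}+h_1L_N$. Standing assumption: the origin is an equilibrium for all $\lambda$, i.e. $g(0,\lambda)=0$. A bifurcation condition for $F^N$ is an equation $g_0+\mu h_1=0$ with $\mu$ an eigenvalue of $L_N$ (the condition associated with $\mu$; it makes $J^N$ singular). Standing genericity assumption: when the bifurcation condition associated with $\mu$ holds, $g_0+\tilde\mu h_1\ne0$ for every other eigenvalue $\tilde\mu\neq\mu$ of $L_N$. The condition is a bifurcation condition for $F^{N_i}$ if $\mu$ is an eigenvalue of $L_{N_i}$. (The eigenvalues of $L_N$ are those of $L_{N_1}$ together with those of $L_{N_2}$.) An equilibrium branch of $F^N$ is a continuous map $b:D\to\mathbb{R}^n$ with $F^N(b(\lambda),\lambda)=0$ on $D$ and $b(0)=0$, where $D$ is of the form $]-\epsilon,\epsilon[$, $[0,\epsilon[$ or $]-\epsilon,0]$ for some $\epsilon>0$. It is a bifurcation branch if $b\not\equiv0$. Branches are considered as germs at $\lambda=0$: $\epsilon$ may be shrunk, branches (on the same type of domain) agreeing near $0$ are identified, and $b\not\equiv0$ means not identically zero on any neighbourhood of $0$ in $D$. *)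

theory Defs
  imports "HOL-Analysis.Derivative" "Jordan_Normal_Form.Char_Poly"
begin

section \<open>Smooth functions\<close>

primrec C_times :: "nat \<Rightarrow> ('a::euclidean_space \<Rightarrow> 'b::real_normed_vector) \<Rightarrow> bool" where
  "C_times 0 f \<longleftrightarrow> continuous_on UNIV f"
| "C_times (Suc k) f \<longleftrightarrow>
     (\<forall>x. f differentiable (at x)) \<and> (\<forall>v. C_times k (\<lambda>x. frechet_derivative f (at x) v))"

definition smooth :: "('a::euclidean_space \<Rightarrow> 'b::real_normed_vector) \<Rightarrow> bool" where
  "smooth f \<longleftrightarrow> (\<forall>k. C_times k f)"

section \<open>Weighted networks\<close>

text \<open>A network with \<open>n\<close> cells is given by its weighted adjacency matrix; the cells are
  \<open>0, \<dots>, n - 1\<close>, and the entry at \<open>(i, j)\<close> is the weight of the edge from \<open>j\<close> to \<open>i\<close>.\<close>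

definition adjacent :: "real mat \<Rightarrow> (nat \<times> nat) set" where
  "adjacent W = {(i, j). i < dim_row W \<and> j < dim_row W \<and> (W $$ (i, j) \<noteq> 0 \<or> W $$ (j, i) \<noteq> 0)}"

definition network :: "nat \<Rightarrow> real mat \<Rightarrow> bool" where
  "network n W \<longleftrightarrow> 0 < n \<and> W \<in> carrier_mat n n \<and> (\<forall>i<n. \<forall>j<n. (i, j) \<in> (adjacent W)\<^sup>*)"

definition valency :: "real mat \<Rightarrow> nat \<Rightarrow> real" where
  "valency W i = (\<Sum>j<dim_col W. W $$ (i, j))"

definition laplacian :: "real mat \<Rightarrow> real mat" where
  "laplacian W = mat_diag (dim_row W) (valency W) - W"

text \<open>The cell \<open>c\<close> along which the networks are joined is the last cell of the first network and
  the first cell of the second one. In the coalescence the cells of the first network are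
  \<open>0, \<dots>, c\<close>, and cell \<open>k\<close> of the second network becomes cell \<open>c + k\<close>.\<close>

definition coalescence :: "real mat \<Rightarrow> real mat \<Rightarrow> real mat" where
  "coalescence W1 W2 =
    (let c = dim_row W1 - 1; n = dim_row W1 + dim_row W2 - 1 in
      mat n n (\<lambda>(a, b).
        if a = c \<and> b = c then W1 $$ (c, c) + W2 $$ (0, 0)
        else if a \<le> c \<and> b \<le> c then W1 $$ (a, b)
        else if c \<le> a \<and> c \<le> b then W2 $$ (a - c, b - c)
        else 0))"

definition feedforward_coalescence :: "nat \<Rightarrow> nat \<Rightarrow> real mat \<Rightarrow> real mat \<Rightarrow> bool" where
  "feedforward_coalescence n1 n2 W1 W2 \<longleftrightarrow>
     network n1 W1 \<and> network n2 W2 \<and> (\<forall>j. 0 < j \<and> j < n2 \<longrightarrow> W2 $$ (0, j) = 0)"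

section \<open>Admissible systems and bifurcation conditions\<close>

definition admissible ::
    "(real \<times> real \<Rightarrow> real) \<Rightarrow> (real \<times> real \<times> real \<Rightarrow> real) \<Rightarrow> real mat \<Rightarrow>
     real vec \<Rightarrow> real \<Rightarrow> real vec" where
  "admissible g h W x l =
     vec (dim_row W) (\<lambda>i. g (x $ i, l) + (\<Sum>j<dim_col W. W $$ (i, j) * h (x $ i, x $ j, l)))"

definition diffusive :: "(real \<times> real \<times> real \<Rightarrow> real) \<Rightarrow> bool" where
  "diffusive h \<longleftrightarrow> (\<forall>z l. h (z, z, l) = 0)"

definition g_deriv :: "(real \<times> real \<Rightarrow> real) \<Rightarrow> real" where
  "g_deriv g = deriv (\<lambda>x. g (x, 0)) 0"

definition h_deriv :: "(real \<times> real \<times> real \<Rightarrow> real) \<Rightarrow> real" where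
  "h_deriv h = deriv (\<lambda>x. h (x, 0, 0)) 0"

text \<open>The Laplacian need not be symmetric, so its eigenvalues are taken in the complex numbers.\<close>

definition laplacian_eigenvalue :: "real mat \<Rightarrow> complex \<Rightarrow> bool" where
  "laplacian_eigenvalue W \<mu> \<longleftrightarrow> eigenvalue (map_mat complex_of_real (laplacian W)) \<mu>"

definition bifurcation_condition ::
    "(real \<times> real \<Rightarrow> real) \<Rightarrow> (real \<times> real \<times> real \<Rightarrow> real) \<Rightarrow> real mat \<Rightarrow> complex \<Rightarrow> bool" where
  "bifurcation_condition g h W \<mu> \<longleftrightarrow>
     laplacian_eigenvalue W \<mu> \<and>
     complex_of_real (g_deriv g) + \<mu> * complex_of_real (h_deriv h) = 0"

definition generic_condition ::
    "(real \<times> real \<Rightarrow> real) \<Rightarrow> (real \<times> real \<times> real \<Rightarrow> real) \<Rightarrow> real mat \<Rightarrow> complex \<Rightarrow> bool" where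
  "generic_condition g h W \<mu> \<longleftrightarrow>
     (\<forall>\<nu>. laplacian_eigenvalue W \<nu> \<and> \<nu> \<noteq> \<mu> \<longrightarrow>
        complex_of_real (g_deriv g) + \<nu> * complex_of_real (h_deriv h) \<noteq> 0)"

section \<open>Branches\<close>

datatype side = Two_Sided | Right_Sided | Left_Sided

fun branch_dom :: "side \<Rightarrow> real \<Rightarrow> real set" where
  "branch_dom Two_Sided \<epsilon> = {-\<epsilon><..<\<epsilon>}"
| "branch_dom Right_Sided \<epsilon> = {0..<\<epsilon>}"
| "branch_dom Left_Sided \<epsilon> = {-\<epsilon><..0}"

definition equilibrium_branch_on ::
    "nat \<Rightarrow> (real vec \<Rightarrow> real \<Rightarrow> real vec) \<Rightarrow> real set \<Rightarrow> (real \<Rightarrow> real vec) \<Rightarrow> bool" where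
  "equilibrium_branch_on n F D b \<longleftrightarrow>
     (\<forall>l\<in>D. b l \<in> carrier_vec n) \<and>
     (\<forall>i<n. continuous_on D (\<lambda>l. b l $ i)) \<and>
     (\<forall>l\<in>D. F (b l) l = 0\<^sub>v n) \<and>
     b 0 = 0\<^sub>v n"

text \<open>Branches are germs at \<open>0\<close>: a function \<open>real \<Rightarrow> real vec\<close> together with a type of domain
  represents a germ through its values near \<open>0\<close> in that domain.\<close>

definition germ_eq :: "side \<Rightarrow> (real \<Rightarrow> 'a) \<Rightarrow> (real \<Rightarrow> 'a) \<Rightarrow> bool" where
  "germ_eq s b b' \<longleftrightarrow> (\<exists>\<epsilon>>0. \<forall>l\<in>branch_dom s \<epsilon>. b l = b' l)"

definition equilibrium_branch ::
    "nat \<Rightarrow> (real vec \<Rightarrow> real \<Rightarrow> real vec) \<Rightarrow> side \<Rightarrow> (real \<Rightarrow> real vec) \<Rightarrow> bool" where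
  "equilibrium_branch n F s b \<longleftrightarrow> (\<exists>\<epsilon>>0. equilibrium_branch_on n F (branch_dom s \<epsilon>) b)"

definition bifurcation_branch ::
    "nat \<Rightarrow> (real vec \<Rightarrow> real \<Rightarrow> real vec) \<Rightarrow> side \<Rightarrow> (real \<Rightarrow> real vec) \<Rightarrow> bool" where
  "bifurcation_branch n F s b \<longleftrightarrow>
     equilibrium_branch n F s b \<and> \<not> germ_eq s b (\<lambda>l. 0\<^sub>v n)"

abbreviation vec1 :: "real \<Rightarrow> real vec" where
  "vec1 x \<equiv> vec 1 (\<lambda>_. x)"

end

theory Submission
  imports "HOL-Probability.Discrete_Topology" Defs
begin

text \<open>
  Since \<open>h\<close> is diffusive and \<open>c\<close> receives no input from the other cells of \<open>N\<^sub>2\<close>, the equations of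
  \<open>N\<close> for the cells of \<open>N\<^sub>1\<close> are those of \<open>N\<^sub>1\<close>, the equation of \<open>N\<^sub>2\<close> at \<open>c\<close> is \<open>g(x\<^sub>c, \<lambda>) = 0\<close>, and
  the other equations of \<open>N\<^sub>2\<close> occur unchanged in \<open>N\<close>.

  Zero is an eigenvalue of every Laplacian. If the condition for \<open>\<mu>\<close> fails for one factor, then
  \<open>\<mu> \<noteq> 0\<close>, genericity excludes \<open>h\<^sub>1 = 0\<close>, and \<open>\<mu> = - g\<^sub>0 / h\<^sub>1\<close> is real and non-zero; so \<open>g\<^sub>0 \<noteq> 0\<close>
  and the Jacobian of that factor is invertible. Its vector field is then locally invertible in the
  state, uniformly in \<open>\<lambda>\<close>.

  In (a), \<open>b\<^sub>2\<close> is obtained by solving \<open>F(x, \<lambda>) = g(b\<^sub>c(\<lambda>), \<lambda>) e\<^sub>c\<close> in \<open>N\<^sub>2\<close>: the equation at \<open>c\<close> reads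
  \<open>g(x\<^sub>c, \<lambda>) = g(b\<^sub>c(\<lambda>), \<lambda>)\<close>, which forces \<open>x\<^sub>c = b\<^sub>c\<close> because \<open>g\<^sub>0 \<noteq> 0\<close>. In (b), \<open>N\<^sub>1\<close> has only the
  trivial branch and \<open>g(b\<^sub>c, \<lambda>) = 0\<close> forces \<open>b\<^sub>c = 0\<close>, so that \<open>b\<^sub>1 = 0\<close> is the only completion.
\<close>

section \<open>Strict differentiability\<close>

text \<open>Near 0 the derivative stays within \<open>\<delta>\<close> of its value at 0 in operator
  norm, and the mean value inequality on a ball, which is convex, transfers this bound to
  differences of \<open>f\<close>.\<close>

lemma C1_strictly_differentiable_at_0:
  fixes f :: "'a::euclidean_space \<Rightarrow> 'b::real_normed_vector"
  assumes C1: "C_times (Suc 0) f" and "\<delta> > 0"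
  obtains r where "r > 0"
    and "\<And>p q. norm p \<le> r \<Longrightarrow> norm q \<le> r \<Longrightarrow>
           norm (f p - f q - frechet_derivative f (at 0) (p - q)) \<le> \<delta> * norm (p - q)"
proof -
  define f' where "f' x = frechet_derivative f (at x)" for x
  have f': "(f has_derivative f' x) (at x)" for x
    using C1 unfolding f'_def C_times.simps by (meson frechet_derivative_works)
  have lin: "linear (f' x)" for x
    using f' has_derivative_linear by blast
  \<comment> \<open>\<open>C_times\<close> gives continuity of \<open>f' x v\<close> only for each
    fixed \<open>v\<close>. Closeness \<open>\<delta> / DIM('a)\<close> on the finitely many basis
    vectors adds up to \<open>\<delta>\<close> in operator norm.\<close>
  have "\<forall>\<^sub>F x in nhds 0. \<forall>b\<in>Basis. dist (f' x b) (f' 0 b) < \<delta> / DIM('a)"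
  proof (intro eventually_ball_finite ballI)
    fix b :: 'a
    have "continuous_on UNIV (\<lambda>x. f' x b)"
      using C1 by (simp add: f'_def)
    then have "((\<lambda>x. f' x b) \<longlongrightarrow> f' 0 b) (nhds 0)"
      by (simp add: continuous_on_eq_continuous_at isCont_def tendsto_nhds_iff)
    then show "\<forall>\<^sub>F x in nhds 0. dist (f' x b) (f' 0 b) < \<delta> / DIM('a)"
      using \<open>\<delta> > 0\<close> by (intro tendstoD) auto
  qed auto
  then obtain d where "d > 0"
    and d: "\<And>x b. dist x 0 < d \<Longrightarrow> b \<in> Basis \<Longrightarrow> dist (f' x b) (f' 0 b) < \<delta> / DIM('a)"
    unfolding eventually_nhds_metric by blast
  \<comment> \<open>Half the radius: the closed ball then lies inside the open ball on which
    \<open>d\<close> controls the derivative.\<close>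
  define S :: "'a set" where "S = cball 0 (d / 2)"
  have onorm: "onorm (f' x - f' 0) \<le> \<delta>" if "x \<in> S" for x
  proof (rule onorm_le)
    fix v :: 'a
    have linD: "linear (f' x - f' 0)"
      using lin[of x] lin[of 0] by (simp add: fun_diff_def linear_compose_sub)
    have "norm ((f' x - f' 0) v) = norm ((f' x - f' 0) (\<Sum>b\<in>Basis. (v \<bullet> b) *\<^sub>R b))"
      by (simp add: euclidean_representation)
    also have "\<dots> = norm (\<Sum>b\<in>Basis. (v \<bullet> b) *\<^sub>R (f' x - f' 0) b)"
      using linD by (simp only: linear_sum linear_scale)
    also have "\<dots> \<le> (\<Sum>b\<in>(Basis :: 'a set). norm v * (\<delta> / DIM('a)))"
    proof (rule sum_norm_le)
      fix b :: 'a assume b: "b \<in> Basis"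
      have "dist x 0 < d"
        using that \<open>d > 0\<close> by (simp add: S_def)
      from d[OF this b] have "norm ((f' x - f' 0) b) \<le> \<delta> / DIM('a)"
        by (simp add: dist_norm)
      then have "\<bar>v \<bullet> b\<bar> * norm ((f' x - f' 0) b) \<le> norm v * (\<delta> / DIM('a))"
        using b by (intro mult_mono Basis_le_norm) auto
      then show "norm ((v \<bullet> b) *\<^sub>R (f' x - f' 0) b) \<le> norm v * (\<delta> / DIM('a))"
        by (simp only: norm_scaleR)
    qed
    also have "\<dots> = \<delta> * norm v"
      by simp
    finally show "norm ((f' x - f' 0) v) \<le> \<delta> * norm v" .
  qed
  have "norm (f p - f q - f' 0 (p - q)) \<le> \<delta> * norm (p - q)"
    if "norm p \<le> d / 2" "norm q \<le> d / 2" for p q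
  proof -
    have "norm (f p - f q - f' 0 (p - q)) \<le> norm (p - q) * \<delta>"
    proof (rule differentiable_bound_linearization[where S = S])
      fix t :: real assume "t \<in> {0..1}"
      then have "(1 - t) *\<^sub>R q + t *\<^sub>R p \<in> S"
        using that by (intro convexD_alt) (auto simp: S_def)
      then show "q + t *\<^sub>R (p - q) \<in> S"
        by (simp add: algebra_simps)
    qed (use \<open>d > 0\<close> f' onorm in \<open>auto simp: S_def intro: has_derivative_at_withinI\<close>)
    then show ?thesis by (simp add: mult.commute)
  qed
  with \<open>d > 0\<close> show ?thesis
    unfolding f'_def by (intro that[of "d/2"]) auto
qed

lemma has_real_derivative_along_curve:
  fixes f :: "'a::real_normed_vector \<Rightarrow> real"
  assumes "f differentiable (at (\<gamma> t))" "(\<gamma> has_vector_derivative v) (at t)"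
  shows "((\<lambda>t. f (\<gamma> t)) has_real_derivative frechet_derivative f (at (\<gamma> t)) v) (at t)"
proof -
  have f: "(f has_derivative frechet_derivative f (at (\<gamma> t))) (at (\<gamma> t))"
    using assms(1) by (simp add: frechet_derivative_works)
  from vector_derivative_diff_chain_within[OF assms(2) has_derivative_at_withinI[OF f]]
  show ?thesis
    by (simp add: o_def has_real_derivative_iff_has_vector_derivative)
qed

section \<open>Linear parts of the internal dynamics and of the coupling\<close>

text \<open>Both points carry the same parameter, so their difference is \<open>(a - b, 0)\<close>
  and only the partial derivative in the state enters. This makes the estimate uniform in
  \<open>l\<close>.\<close>

lemma internal_dynamics_strictly_differentiable:
  assumes "smooth g" "\<delta> > 0"
  shows "\<exists>r>0. \<forall>a b l. \<bar>a\<bar> \<le> r \<longrightarrow> \<bar>b\<bar> \<le> r \<longrightarrow> \<bar>l\<bar> \<le> r \<longrightarrow>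
           \<bar>g (a, l) - g (b, l) - g_deriv g * (a - b)\<bar> \<le> \<delta> * \<bar>a - b\<bar>"
proof -
  have C1: "C_times (Suc 0) g"
    using assms(1) by (simp only: smooth_def)
  then have diff: "g differentiable (at x)" for x by (simp only: C_times.simps)
  define D where "D = frechet_derivative g (at 0)"
  have lin: "linear D"
    using diff unfolding D_def by (simp add: linear_frechet_derivative)
  have "((\<lambda>x. g (x, 0)) has_real_derivative D (1, 0)) (at 0)"
    using has_real_derivative_along_curve[of g "\<lambda>x. (x, 0)" 0 "(1, 0)"] diff
    by (simp add: D_def zero_prod_def has_vector_derivative_def
        has_derivative_Pair has_derivative_ident has_derivative_const)
  then have g0: "D (1, 0) = g_deriv g"
    unfolding g_deriv_def using DERIV_imp_deriv by metis
  have D: "D (x, 0) = g_deriv g * x" for x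
    using linear_scale[OF lin, of x "(1, 0)"] g0 by (simp add: mult.commute)
  obtain r where "r > 0" and r: "\<And>p q. norm p \<le> r \<Longrightarrow> norm q \<le> r \<Longrightarrow>
      norm (g p - g q - D (p - q)) \<le> \<delta> * norm (p - q)"
    using C1_strictly_differentiable_at_0[OF C1 assms(2)] unfolding D_def by blast
  show ?thesis
  proof (intro exI[of _ "r / 2"] conjI allI impI)
    fix a b l :: real assume "\<bar>a\<bar> \<le> r / 2" "\<bar>b\<bar> \<le> r / 2" "\<bar>l\<bar> \<le> r / 2"
    then have "norm (a, l) \<le> r" "norm (b, l) \<le> r"
      using norm_Pair_le[of a l] norm_Pair_le[of b l] by auto
    from r[OF this] show "\<bar>g (a, l) - g (b, l) - g_deriv g * (a - b)\<bar> \<le> \<delta> * \<bar>a - b\<bar>"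
      by (simp add: D norm_Pair)
  qed (use \<open>r > 0\<close> in auto)
qed

text \<open>Diffusivity makes \<open>h\<close> vanish on the diagonal, so its derivative in
  direction \<open>(1, 1, 0)\<close> is zero. The second partial derivative is therefore minus the
  first, and \<open>h_deriv h\<close> alone determines the linear part.\<close>

lemma coupling_strictly_differentiable:
  assumes "smooth h" "diffusive h" "\<delta> > 0"
  shows "\<exists>r>0. \<forall>a b u v l.
           \<bar>a\<bar> \<le> r \<longrightarrow> \<bar>b\<bar> \<le> r \<longrightarrow> \<bar>u\<bar> \<le> r \<longrightarrow> \<bar>v\<bar> \<le> r \<longrightarrow> \<bar>l\<bar> \<le> r \<longrightarrow>
           \<bar>h (a, u, l) - h (b, v, l) - h_deriv h * ((a - b) - (u - v))\<bar>
             \<le> \<delta> * (\<bar>a - b\<bar> + \<bar>u - v\<bar>)"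
proof -
  have C1: "C_times (Suc 0) h"
    using assms(1) by (simp only: smooth_def)
  then have diff: "h differentiable (at x)" for x by (simp only: C_times.simps)
  define D where "D = frechet_derivative h (at 0)"
  have lin: "linear D"
    using diff unfolding D_def by (simp add: linear_frechet_derivative)
  have "((\<lambda>x. h (x, 0, 0)) has_real_derivative D (1, 0, 0)) (at 0)"
    using has_real_derivative_along_curve[of h "\<lambda>x. (x, 0, 0)" 0 "(1, 0, 0)"] diff
    by (simp add: D_def zero_prod_def has_vector_derivative_def
        has_derivative_Pair has_derivative_ident has_derivative_const)
  then have h1: "D (1, 0, 0) = h_deriv h"
    unfolding h_deriv_def using DERIV_imp_deriv by metis
  have "((\<lambda>x. h (x, x, 0)) has_real_derivative D (1, 1, 0)) (at 0)"
    using has_real_derivative_along_curve[of h "\<lambda>x. (x, x, 0)" 0 "(1, 1, 0)"] diff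
    by (simp add: D_def zero_prod_def has_vector_derivative_def
        has_derivative_Pair has_derivative_ident has_derivative_const)
  moreover have "((\<lambda>x. h (x, x, 0)) has_real_derivative 0) (at 0)"
    using assms(2) by (simp add: diffusive_def)
  ultimately have "D (1, 1, 0) = 0"
    using DERIV_unique by blast
  then have D: "D (x, y, 0) = h_deriv h * (x - y)" for x y
    using linear_add[OF lin, of "(x - y) *\<^sub>R (1, 0, 0)" "y *\<^sub>R (1, 1, 0)"] h1
      linear_scale[OF lin, of "x - y" "(1, 0, 0)"] linear_scale[OF lin, of y "(1, 1, 0)"]
    by (simp add: mult.commute)
  obtain r where "r > 0" and r: "\<And>p q. norm p \<le> r \<Longrightarrow> norm q \<le> r \<Longrightarrow>
      norm (h p - h q - D (p - q)) \<le> \<delta> * norm (p - q)"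
    using C1_strictly_differentiable_at_0[OF C1 assms(3)] unfolding D_def by blast
  have n3: "norm (a, b, c) \<le> \<bar>a\<bar> + \<bar>b\<bar> + \<bar>c\<bar>" for a b c :: real
    using norm_Pair_le[of a "(b, c)"] norm_Pair_le[of b c] by simp
  show ?thesis
  proof (intro exI[of _ "r / 3"] conjI allI impI)
    fix a b u v l :: real
    assume "\<bar>a\<bar> \<le> r/3" "\<bar>b\<bar> \<le> r/3" "\<bar>u\<bar> \<le> r/3" "\<bar>v\<bar> \<le> r/3" "\<bar>l\<bar> \<le> r/3"
    then have "norm (a, u, l) \<le> r" "norm (b, v, l) \<le> r"
      using n3[of a u l] n3[of b v l] by linarith+
    from r[OF this]
    have "\<bar>h (a, u, l) - h (b, v, l) - h_deriv h * ((a - b) - (u - v))\<bar>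
        \<le> \<delta> * norm (a - b, u - v, 0::real)"
      by (simp add: D)
    also have "\<dots> \<le> \<delta> * (\<bar>a - b\<bar> + \<bar>u - v\<bar>)"
      using n3[of "a - b" "u - v" 0] assms(3) by (intro mult_left_mono) auto
    finally show "\<bar>h (a, u, l) - h (b, v, l) - h_deriv h * ((a - b) - (u - v))\<bar>
        \<le> \<delta> * (\<bar>a - b\<bar> + \<bar>u - v\<bar>)" .
  qed (use \<open>r > 0\<close> in auto)
qed

section \<open>Local inversion of the vector field of a network\<close>

text \<open>States are functions on all naturals, of which the first \<open>n\<close> values are the
  cells. The fixed point argument below can then run in a space of bounded sequences.\<close>

definition cell_field ::
    "(real \<times> real \<Rightarrow> real) \<Rightarrow> (real \<times> real \<times> real \<Rightarrow> real) \<Rightarrow> nat \<Rightarrow> (nat \<Rightarrow> nat \<Rightarrow> real) \<Rightarrow>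
     (nat \<Rightarrow> real) \<Rightarrow> real \<Rightarrow> nat \<Rightarrow> real" where
  "cell_field g h n w x l i = g (x i, l) + (\<Sum>j<n. w i j * h (x i, x j, l))"

text \<open>This is the matrix \<open>a id + b L\<close> applied to \<open>d\<close>, with the
  Laplacian \<open>L\<close> of \<open>w\<close> written as weighted differences; for
  \<open>a = g_deriv g\<close>, \<open>b = h_deriv h\<close> it is the Jacobian at the
  origin.\<close>

definition cell_lin ::
    "real \<Rightarrow> real \<Rightarrow> nat \<Rightarrow> (nat \<Rightarrow> nat \<Rightarrow> real) \<Rightarrow> (nat \<Rightarrow> real) \<Rightarrow> nat \<Rightarrow> real" where
  "cell_lin a b n w d i = a * d i + b * (\<Sum>j<n. w i j * (d i - d j))"

text \<open>The scalar estimates for \<open>g\<close> and \<open>h\<close> are summed over a row, in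
  the sup norm. The radius is independent of \<open>M\<close>, so the error remains proportional to
  the distance of the two states.\<close>

lemma cell_field_strictly_differentiable:
  assumes "smooth g" "smooth h" "diffusive h" "\<delta> > 0"
  shows "\<exists>r>0. \<forall>x y l M. \<bar>l\<bar> \<le> r \<longrightarrow>
           (\<forall>i<n. \<bar>x i\<bar> \<le> r \<and> \<bar>y i\<bar> \<le> r \<and> \<bar>x i - y i\<bar> \<le> M) \<longrightarrow>
           (\<forall>i<n. \<bar>cell_field g h n w x l i - cell_field g h n w y l i
             - cell_lin (g_deriv g) (h_deriv h) n w (\<lambda>i. x i - y i) i\<bar> \<le> \<delta> * M)"
proof -
  \<comment> \<open>Total weight of the scalar errors: one for \<open>g\<close>, and twice the
    coupling weights, since each coupling error involves the two differences at \<open>i\<close> and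
    \<open>j\<close>. Summing over all rows gives one constant for every \<open>i\<close>.\<close>
  define C where "C = 1 + 2 * (\<Sum>i<n. \<Sum>j<n. \<bar>w i j\<bar>)"
  have C: "C > 0"
    unfolding C_def by (intro add_pos_nonneg mult_nonneg_nonneg sum_nonneg) auto
  define \<eta> where "\<eta> = \<delta> / C"
  have \<eta>: "\<eta> > 0" "\<eta> * C = \<delta>"
    using C assms(4) by (auto simp: \<eta>_def)
  obtain r1 where r1: "r1 > 0" "\<And>a b l. \<bar>a\<bar> \<le> r1 \<Longrightarrow> \<bar>b\<bar> \<le> r1 \<Longrightarrow> \<bar>l\<bar> \<le> r1 \<Longrightarrow>
           \<bar>g (a, l) - g (b, l) - g_deriv g * (a - b)\<bar> \<le> \<eta> * \<bar>a - b\<bar>"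
    using internal_dynamics_strictly_differentiable[OF assms(1) \<eta>(1)] by blast
  obtain r2 where r2: "r2 > 0"
    "\<And>a b u v l. \<bar>a\<bar> \<le> r2 \<Longrightarrow> \<bar>b\<bar> \<le> r2 \<Longrightarrow> \<bar>u\<bar> \<le> r2 \<Longrightarrow> \<bar>v\<bar> \<le> r2 \<Longrightarrow> \<bar>l\<bar> \<le> r2 \<Longrightarrow>
           \<bar>h (a, u, l) - h (b, v, l) - h_deriv h * ((a - b) - (u - v))\<bar>
             \<le> \<eta> * (\<bar>a - b\<bar> + \<bar>u - v\<bar>)"
    using coupling_strictly_differentiable[OF assms(2,3) \<eta>(1)] by blast
  show ?thesis
  proof (intro exI[of _ "min r1 r2"] conjI allI impI)
    fix x y :: "nat \<Rightarrow> real" and l M :: real and i :: nat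
    assume l: "\<bar>l\<bar> \<le> min r1 r2" and i: "i < n"
      and xy: "\<forall>i<n. \<bar>x i\<bar> \<le> min r1 r2 \<and> \<bar>y i\<bar> \<le> min r1 r2 \<and> \<bar>x i - y i\<bar> \<le> M"
    from xy have x: "\<And>i. i < n \<Longrightarrow> \<bar>x i\<bar> \<le> min r1 r2" and y: "\<And>i. i < n \<Longrightarrow> \<bar>y i\<bar> \<le> min r1 r2"
      and M: "\<And>i. i < n \<Longrightarrow> \<bar>x i - y i\<bar> \<le> M" by blast+
    have M0: "M \<ge> 0" using M[OF i] by linarith
    define G where "G = g (x i, l) - g (y i, l) - g_deriv g * (x i - y i)"
    define H where "H j = h (x i, x j, l) - h (y i, y j, l)
      - h_deriv h * ((x i - y i) - (x j - y j))" for j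
    have "\<bar>G\<bar> \<le> \<eta> * \<bar>x i - y i\<bar>"
      unfolding G_def using l x[OF i] y[OF i] by (intro r1(2)) auto
    also have "\<dots> \<le> \<eta> * M"
      using M[OF i] \<eta>(1) by (intro mult_left_mono) auto
    finally have G: "\<bar>G\<bar> \<le> \<eta> * M" .
    have H: "\<bar>H j\<bar> \<le> \<eta> * (2 * M)" if j: "j < n" for j
    proof -
      have "\<bar>H j\<bar> \<le> \<eta> * (\<bar>x i - y i\<bar> + \<bar>x j - y j\<bar>)"
        unfolding H_def using l x[OF i] y[OF i] x[OF j] y[OF j] by (intro r2(2)) auto
      also have "\<dots> \<le> \<eta> * (2 * M)"
        using M[OF i] M[OF j] \<eta>(1) by (intro mult_left_mono) auto
      finally show ?thesis .
    qed
    have eq: "cell_field g h n w x l i - cell_field g h n w y l i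
             - cell_lin (g_deriv g) (h_deriv h) n w (\<lambda>i. x i - y i) i = G + (\<Sum>j<n. w i j * H j)"
      unfolding cell_field_def cell_lin_def G_def H_def
      by (simp add: sum_subtractf sum_distrib_left right_diff_distrib mult.left_commute)
    have "\<bar>\<Sum>j<n. w i j * H j\<bar> \<le> (\<Sum>j<n. \<bar>w i j\<bar> * (\<eta> * (2 * M)))"
      using H by (intro order.trans[OF sum_abs] sum_mono) (auto simp: abs_mult intro: mult_left_mono)
    also have "\<dots> = (\<Sum>j<n. \<bar>w i j\<bar>) * (\<eta> * (2 * M))"
      by (simp add: sum_distrib_right)
    also have "\<dots> \<le> (\<Sum>i<n. \<Sum>j<n. \<bar>w i j\<bar>) * (\<eta> * (2 * M))"
      using i M0 \<eta>(1)
      by (intro mult_right_mono member_le_sum[where f = "\<lambda>i. \<Sum>j<n. \<bar>w i j\<bar>"])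
        (auto intro: sum_nonneg)
    finally have "\<bar>G + (\<Sum>j<n. w i j * H j)\<bar> \<le> \<eta> * C * M"
      using G by (simp add: C_def algebra_simps)
    then show "\<bar>cell_field g h n w x l i - cell_field g h n w y l i
             - cell_lin (g_deriv g) (h_deriv h) n w (\<lambda>i. x i - y i) i\<bar> \<le> \<delta> * M"
      unfolding eq \<eta>(2) .
  qed (use r1 r2 in auto)
qed

text \<open>An inverse function theorem, uniform in the parameter. With \<open>B\<close> inverse to
  the Jacobian, \<open>x - B (F x - y)\<close> contracts by 1/2 near 0. This yields both the
  Lipschitz bound for the inverse and, by Banach's theorem, solvability for small
  \<open>y\<close>.\<close>

lemma cell_field_local_inverse:
  assumes gh: "smooth g" "smooth h" "diffusive h" and g0: "\<And>l. g (0, l) = 0"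
    and left: "\<And>d i. i < n \<Longrightarrow> (\<Sum>j<n. B i j * cell_lin (g_deriv g) (h_deriv h) n w d j) = d i"
    and inj: "\<And>e. (\<And>i. i < n \<Longrightarrow> (\<Sum>j<n. B i j * e j) = 0) \<Longrightarrow> (\<And>j. j < n \<Longrightarrow> e j = (0::real))"
  shows "\<exists>r>0. \<exists>K>0.
    (\<forall>l x y e. \<bar>l\<bar> \<le> r \<and> (\<forall>i<n. \<bar>x i\<bar> \<le> r \<and> \<bar>y i\<bar> \<le> r \<and>
        \<bar>cell_field g h n w x l i - cell_field g h n w y l i\<bar> \<le> e) \<longrightarrow>
      (\<forall>i<n. \<bar>x i - y i\<bar> \<le> K * e)) \<and>
    (\<forall>l y. \<bar>l\<bar> \<le> r \<and> (\<forall>i<n. \<bar>y i\<bar> \<le> r / K) \<longrightarrow>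
      (\<exists>x. \<forall>i<n. \<bar>x i\<bar> \<le> r \<and> cell_field g h n w x l i = y i))"
proof -
  \<comment> \<open>A positive bound for \<open>B\<close> in the sup norm; a linearization error of
    \<open>M / (2 * k)\<close> then becomes at most \<open>M / 2\<close> after applying
    \<open>B\<close>.\<close>
  define k where "k = 1 + (\<Sum>i<n. \<Sum>j<n. \<bar>B i j\<bar>)"
  have k: "k > 0"
    unfolding k_def by (intro add_pos_nonneg sum_nonneg) auto
  let ?F = "\<lambda>x l. cell_field g h n w x l"
  let ?L = "cell_lin (g_deriv g) (h_deriv h) n w"
  have B: "\<bar>\<Sum>j<n. B i j * e j\<bar> \<le> k * m"
    if "\<And>j. j < n \<Longrightarrow> \<bar>e j\<bar> \<le> m" "i < n" for e m i
  proof -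
    have m: "m \<ge> 0" using that(1)[OF that(2)] by linarith
    have "\<bar>\<Sum>j<n. B i j * e j\<bar> \<le> (\<Sum>j<n. \<bar>B i j\<bar> * m)"
      using that(1) by (intro order.trans[OF sum_abs] sum_mono)
        (auto simp: abs_mult intro: mult_left_mono)
    also have "\<dots> = (\<Sum>j<n. \<bar>B i j\<bar>) * m"
      by (simp add: sum_distrib_right)
    also have "\<dots> \<le> (\<Sum>i<n. \<Sum>j<n. \<bar>B i j\<bar>) * m"
      using that(2) m
      by (intro mult_right_mono member_le_sum[where f = "\<lambda>i. \<Sum>j<n. \<bar>B i j\<bar>"])
        (auto intro: sum_nonneg)
    also have "\<dots> \<le> k * m"
      using m by (simp add: k_def distrib_right)
    finally show ?thesis .
  qed
  have "1 / (2 * k) > 0" using k by simp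
  obtain r where r: "r > 0"
    and F: "\<forall>x y l M. \<bar>l\<bar> \<le> r \<longrightarrow>
           (\<forall>i<n. \<bar>x i\<bar> \<le> r \<and> \<bar>y i\<bar> \<le> r \<and> \<bar>x i - y i\<bar> \<le> M) \<longrightarrow>
           (\<forall>i<n. \<bar>?F x l i - ?F y l i - ?L (\<lambda>i. x i - y i) i\<bar> \<le> 1 / (2 * k) * M)"
    using cell_field_strictly_differentiable[OF gh \<open>1 / (2 * k) > 0\<close>, of n w] by blast
  \<comment> \<open>By \<open>left\<close>, \<open>B\<close> recovers \<open>x - y\<close> from the
    linear part, so only the linearization error passes through \<open>B\<close>.\<close>
  have contr: "\<bar>(x i - y i) - (\<Sum>j<n. B i j * (?F x l j - ?F y l j))\<bar> \<le> M / 2"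
    if "\<bar>l\<bar> \<le> r" "\<And>i. i < n \<Longrightarrow> \<bar>x i\<bar> \<le> r" "\<And>i. i < n \<Longrightarrow> \<bar>y i\<bar> \<le> r"
      "\<And>i. i < n \<Longrightarrow> \<bar>x i - y i\<bar> \<le> M" "i < n" for l x y M i
  proof -
    have "(x i - y i) - (\<Sum>j<n. B i j * (?F x l j - ?F y l j))
       = - (\<Sum>j<n. B i j * (?F x l j - ?F y l j - ?L (\<lambda>i. x i - y i) j))"
      using left[OF that(5), of "\<lambda>i. x i - y i"]
      by (simp add: right_diff_distrib sum_subtractf)
    moreover have "\<bar>\<Sum>j<n. B i j * (?F x l j - ?F y l j - ?L (\<lambda>i. x i - y i) j)\<bar>
        \<le> k * ((1 / (2 * k)) * M)"
      using F that by (intro B) auto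
    ultimately show ?thesis using k by simp
  qed
  show ?thesis
  \<comment> \<open>The constant \<open>2 * k\<close> serves twice: it comes from solving
    \<open>M <= M / 2 + k * e\<close> for \<open>M\<close>, and data below
    \<open>r / (2 * k)\<close> are mapped by \<open>B\<close> below \<open>r / 2\<close>.\<close>
  proof (rule exI[of _ r], rule conjI[OF r], rule exI[of _ "2 * k"], intro conjI allI impI;
      (elim conjE)?)
    fix l e :: real and x y i
    assume l: "\<bar>l\<bar> \<le> r" and i: "i < n"
      and xy: "\<forall>i<n. \<bar>x i\<bar> \<le> r \<and> \<bar>y i\<bar> \<le> r \<and> \<bar>?F x l i - ?F y l i\<bar> \<le> e"
    from xy have x: "\<And>i. i < n \<Longrightarrow> \<bar>x i\<bar> \<le> r" and y: "\<And>i. i < n \<Longrightarrow> \<bar>y i\<bar> \<le> r"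
      and e: "\<And>j. j < n \<Longrightarrow> \<bar>?F x l j - ?F y l j\<bar> \<le> e" by blast+
    \<comment> \<open>The largest difference is attained at some cell \<open>i0\<close>;
      \<open>contr\<close> at that cell bounds \<open>M\<close> by half of itself plus
      \<open>k * e\<close>.\<close>
    define M where "M = Max ((\<lambda>i. \<bar>x i - y i\<bar>) ` {..<n})"
    have M: "\<bar>x i - y i\<bar> \<le> M" if "i < n" for i
      unfolding M_def using that by (intro Max_ge) auto
    have "M \<in> (\<lambda>i. \<bar>x i - y i\<bar>) ` {..<n}"
      unfolding M_def using i by (intro Max_in) auto
    then obtain i0 where i0: "i0 < n" "M = \<bar>x i0 - y i0\<bar>" by auto
    have "\<bar>\<Sum>j<n. B i0 j * (?F x l j - ?F y l j)\<bar> \<le> k * e"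
      using e i0(1) by (intro B)
    with contr[of l x y M i0, OF l x y M i0(1)] i0(2) have "M \<le> 2 * k * e"
      by linarith
    with M[OF i] show "\<bar>x i - y i\<bar> \<le> 2 * k * e" by linarith
  next
    fix l :: real and y :: "nat \<Rightarrow> real"
    assume l: "\<bar>l\<bar> \<le> r" and "\<forall>i<n. \<bar>y i\<bar> \<le> r / (2 * k)"
    then have y: "\<And>j. j < n \<Longrightarrow> \<bar>y j\<bar> \<le> r / (2 * k)" by blast
    \<comment> \<open>Newton iteration with the fixed approximate inverse \<open>B\<close>. The
      value 0 beyond the cells makes the bounds below hold at every index.\<close>
    define t where "t x i = (if i < n then x i - (\<Sum>j<n. B i j * (?F x l j - y j)) else 0)"
      for x :: "nat \<Rightarrow> real" and i
    have lip: "\<bar>t u i - t v i\<bar> \<le> M / 2"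
      if "\<And>i. \<bar>u i\<bar> \<le> r" "\<And>i. \<bar>v i\<bar> \<le> r" "\<And>i. \<bar>u i - v i\<bar> \<le> M" for u v M i
    proof (cases "i < n")
      case True
      have "t u i - t v i = (u i - v i) - (\<Sum>j<n. B i j * (?F u l j - ?F v l j))"
        using True by (simp add: t_def right_diff_distrib sum_subtractf)
      then show ?thesis using contr[of l u v M i] l that True by simp
    next
      case False
      have "M \<ge> 0" using that(3)[of 0] by linarith
      with False show ?thesis by (simp add: t_def)
    qed
    \<comment> \<open>The field vanishes at the zero state, so \<open>t\<close> sends it to
      \<open>B y\<close>, of size at most \<open>r / 2\<close>. With \<open>lip\<close> for
      \<open>M = r\<close> this keeps the ball of radius \<open>r\<close> invariant.\<close>
    have t0: "\<bar>t (\<lambda>_. 0) i\<bar> \<le> r / 2" for i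
    proof (cases "i < n")
      case True
      have "?F (\<lambda>_. 0) l j = 0" for j
        using g0 gh(3) by (simp add: cell_field_def diffusive_def)
      then have "t (\<lambda>_. 0) i = (\<Sum>j<n. B i j * y j)"
        using True by (simp add: t_def sum_negf)
      then show ?thesis using B[OF y True] k by simp
    qed (use r in \<open>auto simp: t_def\<close>)
    have self: "\<bar>t u i\<bar> \<le> r" if "\<And>i. \<bar>u i\<bar> \<le> r" for u i
    proof -
      have "\<bar>t u i - t (\<lambda>_. 0) i\<bar> \<le> r / 2"
        using that r by (intro lip) auto
      with t0[of i] show ?thesis by linarith
    qed
    \<comment> \<open>The number \<open>n\<close> of cells is not a type, so the fixed point is taken in the Banach space
      \<open>\<ell>\<^sup>\<infinity>\<close>, that is, bounded functions on the discrete space of naturals.\<close>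
    define c where "c f i = apply_bcontfun f (discrete i)" for f :: "nat discrete \<Rightarrow>\<^sub>C real" and i
    define T where "T f = Bcontfun (\<lambda>i. t (c f) (of_discrete i))" for f
    have cont: "continuous_on UNIV q" for q :: "nat discrete \<Rightarrow> real"
      by (simp add: continuous_on_open_vimage open_discrete)
    have ball: "\<bar>c f i\<bar> \<le> r" if "f \<in> cball 0 r" for f i
      using that norm_bounded[of f "discrete i"] by (simp add: c_def)
    \<comment> \<open>\<open>Bcontfun\<close> is meaningful only on bounded functions; on the ball,
      \<open>self\<close> supplies the bound.\<close>
    have T: "apply_bcontfun (T f) i = t (c f) (of_discrete i)" if "f \<in> cball 0 r" for f i
      unfolding T_def using self ball[OF that]
      by (subst Bcontfun_inverse) (auto intro!: bcontfun_normI[of _ r] cont)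
    have "\<exists>!f. f \<in> cball 0 r \<and> T f = f"
    proof (rule Banach_fix[of _ "1/2"])
      show "T ` cball 0 r \<subseteq> cball 0 r"
        using self T ball by (auto intro!: norm_bound)
      show "dist (T f1) (T f2) \<le> 1 / 2 * dist f1 f2"
        if "f1 \<in> cball 0 r" "f2 \<in> cball 0 r" for f1 f2
      proof (rule dist_bound)
        fix i
        have "\<bar>c f1 i - c f2 i\<bar> \<le> dist f1 f2" for i
          using dist_bounded[of f1 "discrete i" f2] by (simp add: dist_norm c_def)
        with lip[of "c f1" "c f2" "dist f1 f2" "of_discrete i"] ball that
        show "dist (T f1 i) (T f2 i) \<le> 1 / 2 * dist f1 f2"
          using T by (simp add: dist_norm)
      qed
    qed (use r in \<open>auto simp: complete_eq_closed\<close>)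
    then obtain f where f: "f \<in> cball 0 r" "T f = f" by blast
    have fp: "t (c f) i = c f i" for i
      using T[OF f(1), of "discrete i"] f(2) by (simp add: c_def discrete_inverse)
    \<comment> \<open>The fixed point equation says only that \<open>B\<close> annihilates
      \<open>F x - y\<close>; \<open>inj\<close> then gives the equation itself.\<close>
    have zero: "(\<Sum>j<n. B i j * (?F (c f) l j - y j)) = 0" if "i < n" for i
      using fp[of i] that unfolding t_def by simp
    have "?F (c f) l i - y i = 0" if "i < n" for i
      using zero that by (rule inj)
    with ball[OF f(1)] show "\<exists>x. (\<forall>i<n. \<bar>x i\<bar> \<le> r \<and> ?F x l i = y i)"
      by (intro exI[of _ "c f"]) simp
  qed (use r k in auto)
qed

section \<open>Laplacians and coalescence\<close>

lemma admissible_eq_cell_field: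
  assumes "W \<in> carrier_mat n n" "i < n"
  shows "admissible g h W v l $ i = cell_field g h n (\<lambda>i j. W $$ (i, j)) (\<lambda>i. v $ i) l i"
  using assms by (auto simp: admissible_def cell_field_def)

lemma cell_field_cong:
  assumes "\<And>i. i < n \<Longrightarrow> x i = y i" "i < n"
  shows "cell_field g h n w x l i = cell_field g h n w y l i"
  using assms by (simp add: cell_field_def)

text \<open>The diagonal entry is the row sum of the weights, so each weight meets a difference of
  states. This is the shape that the linearized diffusive coupling has in
  \<open>cell_lin\<close>.\<close>

lemma laplacian_mult_vec:
  assumes "W \<in> carrier_mat n n" "v \<in> carrier_vec n" "i < n"
  shows "(laplacian W *\<^sub>v v) $ i = (\<Sum>j<n. W $$ (i, j) * (v $ i - v $ j))"
proof -
  have "(laplacian W *\<^sub>v v) $ i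
    = (\<Sum>j<n. ((if i = j then valency W i else 0) - W $$ (i, j)) * v $ j)"
    using assms by (auto simp: laplacian_def mat_diag_def scalar_prod_def lessThan_atLeast0
        intro!: sum.cong)
  also have "\<dots> = (\<Sum>j<n. (if j = i then valency W i * v $ j else 0)) - (\<Sum>j<n. W $$ (i, j) * v $ j)"
    by (simp add: left_diff_distrib sum_subtractf if_distrib[where f = "\<lambda>x. x * _"] eq_commute
        cong: if_cong)
  also have "(\<Sum>j<n. (if j = i then valency W i * v $ j else 0)) = (\<Sum>j<n. W $$ (i, j) * v $ i)"
    using assms by (simp add: valency_def sum_distrib_right)
  finally show ?thesis
    by (simp add: right_diff_distrib sum_subtractf)
qed

lemma laplacian_carrier:
  "W \<in> carrier_mat n n \<Longrightarrow> laplacian W \<in> carrier_mat n n"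
  by (auto simp: laplacian_def mat_diag_def)

section \<open>Eigenvalues of the Laplacian and invertibility of the Jacobian\<close>

lemma real_laplacian_eigenvalueI:
  assumes W: "W \<in> carrier_mat n n" and v: "v \<in> carrier_vec n" "v \<noteq> 0\<^sub>v n"
    and eq: "\<And>i. i < n \<Longrightarrow> (\<Sum>j<n. W $$ (i, j) * (v $ i - v $ j)) = k * v $ i"
  shows "laplacian_eigenvalue W (complex_of_real k)"
proof -
  have "laplacian W *\<^sub>v v = k \<cdot>\<^sub>v v"
    using laplacian_mult_vec[OF W v(1)] eq v(1) laplacian_carrier[OF W] by (intro eq_vecI) auto
  then have "eigenvector (laplacian W) v k"
    using v laplacian_carrier[OF W] by (auto simp: eigenvector_def)
  from of_real_hom.eigenvector_hom[OF laplacian_carrier[OF W] this]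
  show ?thesis
    unfolding laplacian_eigenvalue_def eigenvalue_def by blast
qed

lemma laplacian_eigenvalue_0:
  assumes "W \<in> carrier_mat n n" "n > 0"
  shows "laplacian_eigenvalue W 0"
proof -
  have "vec n (\<lambda>_. 1) \<noteq> (0\<^sub>v n :: real vec)"
    using assms(2) by (metis index_vec index_zero_vec(1) zero_neq_one)
  then show ?thesis
    using real_laplacian_eigenvalueI[OF assms(1), of "vec n (\<lambda>_. 1)" 0] by simp
qed

text \<open>Since 0 is an eigenvalue of \<open>W\<close>, \<open>\<mu>\<close> is not 0. If
  \<open>h_deriv h\<close> were 0, the condition would give \<open>g_deriv g = 0\<close>, so the
  eigenvalue 0 of \<open>N\<close> would satisfy it too, against genericity. Solving the condition
  for \<open>\<mu>\<close> identifies it with \<open>- g_deriv g / h_deriv h\<close>.\<close>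

lemma bifurcation_condition_off_factor:
  assumes N: "bifurcation_condition g h N \<mu>" "generic_condition g h N \<mu>"
    and "N \<in> carrier_mat m m" "m > 0"
    and W: "W \<in> carrier_mat n n" "n > 0" and off: "\<not> bifurcation_condition g h W \<mu>"
  shows "g_deriv g \<noteq> 0" "h_deriv h \<noteq> 0"
    "\<not> laplacian_eigenvalue W (complex_of_real (- g_deriv g / h_deriv h))"
proof -
  have eq: "complex_of_real (g_deriv g) + \<mu> * complex_of_real (h_deriv h) = 0"
    and W\<mu>: "\<not> laplacian_eigenvalue W \<mu>"
    using N(1) off by (auto simp: bifurcation_condition_def)
  have "\<mu> \<noteq> 0"
    using W\<mu> laplacian_eigenvalue_0[OF W] by blast
  show h1: "h_deriv h \<noteq> 0"
  proof
    assume "h_deriv h = 0"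
    with eq N(2) laplacian_eigenvalue_0[OF assms(3,4)] \<open>\<mu> \<noteq> 0\<close> show False
      by (auto simp: generic_condition_def)
  qed
  with eq \<open>\<mu> \<noteq> 0\<close> show "g_deriv g \<noteq> 0" by auto
  have "\<mu> = complex_of_real (- g_deriv g / h_deriv h)"
    using eq h1 by (simp add: field_simps add_eq_0_iff)
  with W\<mu> show "\<not> laplacian_eigenvalue W (complex_of_real (- g_deriv g / h_deriv h))" by simp
qed

text \<open>A real kernel vector of \<open>a id + b L\<close> is an eigenvector of \<open>L\<close>
  for \<open>- a / b\<close>, so the matrix is invertible. Of its inverse \<open>C\<close>, the
  identity \<open>C * A = 1\<close> gives the first property and \<open>A * C = 1\<close> the
  second.\<close>

lemma cell_lin_inverse:
  assumes W: "W \<in> carrier_mat n n" and b: "b \<noteq> 0"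
    and "\<not> laplacian_eigenvalue W (complex_of_real (- a / b))"
  obtains B where
    "\<And>d i. i < n \<Longrightarrow> (\<Sum>j<n. B i j * cell_lin a b n (\<lambda>i j. W $$ (i, j)) d j) = d i"
    "\<And>e j. (\<And>i. i < n \<Longrightarrow> (\<Sum>j<n. B i j * e j) = 0) \<Longrightarrow> j < n \<Longrightarrow> e j = (0::real)"
proof -
  let ?w = "\<lambda>i j. W $$ (i, j)"
  define A where "A = a \<cdot>\<^sub>m 1\<^sub>m n + b \<cdot>\<^sub>m laplacian W"
  have A: "A \<in> carrier_mat n n"
    using laplacian_carrier[OF W] by (simp add: A_def)
  have Av: "(A *\<^sub>v v) $ i = cell_lin a b n ?w (\<lambda>i. v $ i) i" if "v \<in> carrier_vec n" "i < n" for v i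
  proof -
    have "(k \<cdot>\<^sub>m M) *\<^sub>v v = k \<cdot>\<^sub>v (M *\<^sub>v v)" if "M \<in> carrier_mat n n" for k and M :: "real mat"
      using that \<open>v \<in> carrier_vec n\<close>
      by (auto simp: scalar_prod_def sum_distrib_left mult.assoc intro!: eq_vecI)
    then have "A *\<^sub>v v = a \<cdot>\<^sub>v v + b \<cdot>\<^sub>v (laplacian W *\<^sub>v v)"
      unfolding A_def using laplacian_carrier[OF W] that(1)
      by (simp add: add_mult_distrib_mat_vec[of _ n n])
    then show ?thesis
      using laplacian_mult_vec[OF W that] that laplacian_carrier[OF W] by (simp add: cell_lin_def)
  qed
  have "det A \<noteq> 0"
  proof
    assume "det A = 0"
    then obtain v where v: "v \<in> carrier_vec n" "v \<noteq> 0\<^sub>v n" "A *\<^sub>v v = 0\<^sub>v n"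
      using det_0_iff_vec_prod_zero[OF A] by blast
    have "laplacian_eigenvalue W (complex_of_real (- a / b))"
    proof (rule real_laplacian_eigenvalueI[OF W v(1,2)])
      fix i assume "i < n"
      then have "a * v $ i + b * (\<Sum>j<n. W $$ (i, j) * (v $ i - v $ j)) = 0"
        using Av[OF v(1)] v(3) by (simp add: cell_lin_def)
      then show "(\<Sum>j<n. W $$ (i, j) * (v $ i - v $ j)) = - a / b * v $ i"
        using b by (simp add: field_simps add_eq_0_iff)
    qed
    with assms(3) show False by blast
  qed
  from det_non_zero_imp_unit[OF A this]
  obtain C where C: "C \<in> carrier_mat n n" "C * A = 1\<^sub>m n" "A * C = 1\<^sub>m n"
    unfolding Units_def by (auto simp: ring_mat_simps)
  have Cv: "(C *\<^sub>v v) $ i = (\<Sum>j<n. C $$ (i, j) * v $ j)" if "v \<in> carrier_vec n" "i < n" for v i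
    using C(1) that by (auto simp: scalar_prod_def lessThan_atLeast0 intro!: sum.cong)
  show ?thesis
  proof (rule that[of "\<lambda>i j. C $$ (i, j)"])
    fix d :: "nat \<Rightarrow> real" and i assume i: "i < n"
    have "(\<Sum>j<n. C $$ (i, j) * cell_lin a b n ?w d j) = (C *\<^sub>v (A *\<^sub>v vec n d)) $ i"
      using A i by (subst Cv) (auto simp: Av cell_lin_def simp del: index_mult_mat_vec)
    also have "C *\<^sub>v (A *\<^sub>v vec n d) = (C * A) *\<^sub>v vec n d"
      using A C(1) by (intro assoc_mult_mat_vec[symmetric]) auto
    finally show "(\<Sum>j<n. C $$ (i, j) * cell_lin a b n ?w d j) = d i"
      using C(2) i by simp
  next
    fix e :: "nat \<Rightarrow> real" and j
    assume e: "\<And>i. i < n \<Longrightarrow> (\<Sum>j<n. C $$ (i, j) * e j) = 0" and j: "j < n"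
    have "C *\<^sub>v vec n e = 0\<^sub>v n"
      using e C(1) Cv[of "vec n e"] by (intro eq_vecI) auto
    then have "(A * C) *\<^sub>v vec n e = 0\<^sub>v n"
      using A C(1) by (subst assoc_mult_mat_vec[of _ n n _ n]) auto
    then show "e j = 0"
      using C(3) j by (metis index_vec index_zero_vec(1) one_mult_mat_vec vec_carrier)
  qed
qed

section \<open>Equations of a feedforward coalescence\<close>

lemma coalescence_carrier:
  assumes "W1 \<in> carrier_mat n1 n1" "W2 \<in> carrier_mat n2 n2"
  shows "coalescence W1 W2 \<in> carrier_mat (n1 + n2 - 1) (n1 + n2 - 1)"
  using assms by (auto simp: coalescence_def Let_def)

lemma feedforward_coalescence_carrier:
  assumes "feedforward_coalescence n1 n2 W1 W2"
  shows "W1 \<in> carrier_mat n1 n1" "W2 \<in> carrier_mat n2 n2" "n1 > 0" "n2 > 0"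
  using assms by (auto simp: feedforward_coalescence_def network_def)

text \<open>The self-loop contributes \<open>h (x 0, x 0, l) = 0\<close> by diffusivity, and the
  other inputs have weight 0 by the feedforward condition.\<close>

lemma feedforward_cell_field_0:
  assumes "feedforward_coalescence n1 n2 W1 W2" "diffusive h"
  shows "cell_field g h n2 (\<lambda>i j. W2 $$ (i, j)) x l 0 = g (x 0, l)"
proof -
  have "W2 $$ (0, j) * h (x 0, x j, l) = 0" if "j < n2" for j
    using assms that by (cases "j = 0") (auto simp: feedforward_coalescence_def diffusive_def)
  then have "(\<Sum>j<n2. W2 $$ (0, j) * h (x 0, x j, l)) = 0"
    by (intro sum.neutral ballI) blast
  then show ?thesis by (simp add: cell_field_def)
qed

text \<open>Inputs from beyond \<open>c\<close> have weight 0: by the definition of coalescence for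
  cells before \<open>c\<close>, by the feedforward condition for \<open>c\<close> itself. The one
  altered weight, the self-loop at \<open>c\<close>, multiplies a vanishing coupling term.\<close>

lemma coalescence_cell_field_fst:
  assumes FF: "feedforward_coalescence n1 n2 W1 W2" and h: "diffusive h" and i: "i < n1"
  shows "cell_field g h (n1 + n2 - 1) (\<lambda>i j. coalescence W1 W2 $$ (i, j)) x l i
       = cell_field g h n1 (\<lambda>i j. W1 $$ (i, j)) x l i"
proof -
  note car = feedforward_coalescence_carrier[OF FF]
  have z: "W2 $$ (0, j) = 0" if "0 < j" "j < n2" for j
    using FF that by (simp add: feedforward_coalescence_def)
  have "(\<Sum>j<n1 + n2 - 1. coalescence W1 W2 $$ (i, j) * h (x i, x j, l))
      = (\<Sum>j<n1. W1 $$ (i, j) * h (x i, x j, l))"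
  proof (rule sum.mono_neutral_cong_right)
    show "\<forall>j\<in>{..<n1 + n2 - 1} - {..<n1}. coalescence W1 W2 $$ (i, j) * h (x i, x j, l) = 0"
    proof
      fix j assume "j \<in> {..<n1 + n2 - 1} - {..<n1}"
      then have "n1 \<le> j" "j < n1 + n2 - 1" by auto
      then show "coalescence W1 W2 $$ (i, j) * h (x i, x j, l) = 0"
        using car i z[of "j - (n1 - 1)"] by (auto simp: coalescence_def Let_def)
    qed
    show "coalescence W1 W2 $$ (i, j) * h (x i, x j, l) = W1 $$ (i, j) * h (x i, x j, l)"
      if "j \<in> {..<n1}" for j
      using that car i h by (auto simp: coalescence_def Let_def diffusive_def)
  qed (use car in auto)
  then show ?thesis by (simp add: cell_field_def)
qed

text \<open>Cells after \<open>c\<close> receive nothing from cells before \<open>c\<close>, so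
  their inputs are those in the second network with indices shifted by \<open>n1 - 1\<close>. The
  case \<open>k = 0\<close> is left to the first network, to whose last cell it belongs.\<close>

lemma coalescence_cell_field_snd:
  assumes FF: "feedforward_coalescence n1 n2 W1 W2" and k: "0 < k" "k < n2"
  shows "cell_field g h (n1 + n2 - 1) (\<lambda>i j. coalescence W1 W2 $$ (i, j)) x l (n1 - 1 + k)
       = cell_field g h n2 (\<lambda>i j. W2 $$ (i, j)) (\<lambda>i. x (n1 - 1 + i)) l k"
proof -
  note car = feedforward_coalescence_carrier[OF FF]
  let ?c = "n1 - 1"
  have "(\<Sum>j<n1 + n2 - 1. coalescence W1 W2 $$ (?c + k, j) * h (x (?c + k), x j, l))
      = (\<Sum>j\<in>(+) ?c ` {..<n2}. W2 $$ (k, j - ?c) * h (x (?c + k), x j, l))"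
  proof (rule sum.mono_neutral_cong_right)
    show "\<forall>j\<in>{..<n1 + n2 - 1} - (+) ?c ` {..<n2}.
        coalescence W1 W2 $$ (?c + k, j) * h (x (?c + k), x j, l) = 0"
    proof
      fix j assume j: "j \<in> {..<n1 + n2 - 1} - (+) ?c ` {..<n2}"
      have "j < ?c"
      proof (rule ccontr)
        assume "\<not> j < ?c"
        then have "j = ?c + (j - ?c)" "j - ?c < n2" using j car by auto
        with j show False by blast
      qed
      then show "coalescence W1 W2 $$ (?c + k, j) * h (x (?c + k), x j, l) = 0"
        using car k by (auto simp: coalescence_def Let_def)
    qed
    show "coalescence W1 W2 $$ (?c + k, j) * h (x (?c + k), x j, l)
        = W2 $$ (k, j - ?c) * h (x (?c + k), x j, l)" if "j \<in> (+) ?c ` {..<n2}" for j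
      using that car k by (cases n1) (auto simp: coalescence_def Let_def)
  qed (use car in auto)
  also have "\<dots> = (\<Sum>j<n2. W2 $$ (k, j) * h (x (?c + k), x (?c + j), l))"
    by (subst sum.reindex) auto
  finally show ?thesis by (simp add: cell_field_def)
qed

text \<open>The system is triangular: the first network is autonomous and drives the rest through
  \<open>xc\<close>. The row of \<open>c\<close> is counted once, within the first network, hence
  \<open>0 < i\<close> for the second.\<close>

lemma admissible_coalescence_eq_0_iff:
  assumes FF: "feedforward_coalescence n1 n2 W1 W2" and h: "diffusive h"
    and x1: "x1 \<in> carrier_vec (n1 - 1)" and x2: "x2 \<in> carrier_vec (n2 - 1)"
  shows "admissible g h (coalescence W1 W2) (x1 @\<^sub>v vec1 xc @\<^sub>v x2) l = 0\<^sub>v (n1 + n2 - 1) \<longleftrightarrow>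
    admissible g h W1 (x1 @\<^sub>v vec1 xc) l = 0\<^sub>v n1 \<and>
    (\<forall>i. 0 < i \<and> i < n2 \<longrightarrow> admissible g h W2 (vec1 xc @\<^sub>v x2) l $ i = 0)"
proof -
  note car = feedforward_coalescence_carrier[OF FF]
  note cN = coalescence_carrier[OF car(1,2)]
  let ?v = "x1 @\<^sub>v vec1 xc @\<^sub>v x2"
  have fst: "admissible g h (coalescence W1 W2) ?v l $ i = admissible g h W1 (x1 @\<^sub>v vec1 xc) l $ i"
    if "i < n1" for i
  proof -
    have "cell_field g h n1 (\<lambda>i j. W1 $$ (i, j)) (\<lambda>i. ?v $ i) l i
        = cell_field g h n1 (\<lambda>i j. W1 $$ (i, j)) (\<lambda>i. (x1 @\<^sub>v vec1 xc) $ i) l i"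
      using that x1 x2 car by (intro cell_field_cong) auto
    then show ?thesis
      using that car coalescence_cell_field_fst[OF FF h that]
      by (simp add: admissible_eq_cell_field[OF cN] admissible_eq_cell_field[OF car(1)])
  qed
  have snd: "admissible g h (coalescence W1 W2) ?v l $ (n1 - 1 + k)
      = admissible g h W2 (vec1 xc @\<^sub>v x2) l $ k" if "0 < k" "k < n2" for k
  proof -
    have "cell_field g h n2 (\<lambda>i j. W2 $$ (i, j)) (\<lambda>i. ?v $ (n1 - 1 + i)) l k
        = cell_field g h n2 (\<lambda>i j. W2 $$ (i, j)) (\<lambda>i. (vec1 xc @\<^sub>v x2) $ i) l k"
      using that x1 x2 car by (intro cell_field_cong) auto
    then show ?thesis
      using that car coalescence_cell_field_snd[OF FF that]
      by (simp add: admissible_eq_cell_field[OF cN] admissible_eq_cell_field[OF car(2)])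
  qed
  have "admissible g h (coalescence W1 W2) ?v l = 0\<^sub>v (n1 + n2 - 1) \<longleftrightarrow>
      (\<forall>i<n1 + n2 - 1. admissible g h (coalescence W1 W2) ?v l $ i = 0)"
    using cN by (auto simp: vec_eq_iff admissible_def)
  also have "\<dots> \<longleftrightarrow> (\<forall>i<n1. admissible g h (coalescence W1 W2) ?v l $ i = 0) \<and>
      (\<forall>k. 0 < k \<and> k < n2 \<longrightarrow> admissible g h (coalescence W1 W2) ?v l $ (n1 - 1 + k) = 0)"
    (is "?L \<longleftrightarrow> ?R")
  proof
    assume ?R
    show ?L
    proof (intro allI impI)
      fix i assume "i < n1 + n2 - 1"
      then consider "i < n1" | "i = n1 - 1 + (i - (n1 - 1))" "0 < i - (n1 - 1)" "i - (n1 - 1) < n2"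
        using car by linarith
      then show "admissible g h (coalescence W1 W2) ?v l $ i = 0"
        using \<open>?R\<close> by cases metis+
    qed
  qed (use car in auto)
  also have "(\<forall>i<n1. admissible g h (coalescence W1 W2) ?v l $ i = 0) \<longleftrightarrow>
      admissible g h W1 (x1 @\<^sub>v vec1 xc) l = 0\<^sub>v n1"
    using car fst by (auto simp: vec_eq_iff admissible_def)
  also have "(\<forall>k. 0 < k \<and> k < n2 \<longrightarrow> admissible g h (coalescence W1 W2) ?v l $ (n1 - 1 + k) = 0)
      \<longleftrightarrow> (\<forall>i. 0 < i \<and> i < n2 \<longrightarrow> admissible g h W2 (vec1 xc @\<^sub>v x2) l $ i = 0)"
    using snd by auto
  finally show ?thesis .
qed

section \<open>Germs of branches\<close>

text \<open>Statements about germs become \<open>eventually\<close> statements, so finitely many of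
  them combine without tracking radii. Unlike a punctured neighbourhood filter, this one includes
  the parameter 0.\<close>

definition germ_filter :: "side \<Rightarrow> real filter" where
  "germ_filter s = (INF \<epsilon>\<in>{0<..}. principal (branch_dom s \<epsilon>))"

lemma mem_branch_dom_iff:
  "l \<in> branch_dom s \<epsilon> \<longleftrightarrow>
    \<bar>l\<bar> < \<epsilon> \<and> (s = Right_Sided \<longrightarrow> 0 \<le> l) \<and> (s = Left_Sided \<longrightarrow> l \<le> 0)"
  by (cases s) auto

lemma eventually_germ_filter:
  "eventually P (germ_filter s) \<longleftrightarrow> (\<exists>\<epsilon>>0. \<forall>l\<in>branch_dom s \<epsilon>. P l)"
  unfolding germ_filter_def
proof (subst eventually_INF_base)
  fix a b :: real assume "a \<in> {0<..}" "b \<in> {0<..}"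
  then show "\<exists>x\<in>{0<..}. principal (branch_dom s x)
      \<le> inf (principal (branch_dom s a)) (principal (branch_dom s b))"
    by (intro bexI[of _ "min a b"]) (auto simp: mem_branch_dom_iff)
qed (auto simp: eventually_principal)

lemma germ_eq_iff_eventually:
  "germ_eq s b b' \<longleftrightarrow> (\<forall>\<^sub>F l in germ_filter s. b l = b' l)"
  by (simp add: germ_eq_def eventually_germ_filter)

lemma eventually_germ_filter_abs_le:
  "r > 0 \<Longrightarrow> \<forall>\<^sub>F l in germ_filter s. \<bar>l\<bar> \<le> r"
  unfolding eventually_germ_filter by (intro exI[of _ r]) (auto simp: mem_branch_dom_iff)

text \<open>Continuity on a whole domain around 0, as branches require, and not only at 0. It is not
  a pointwise property of \<open>l\<close> and so needs a notion beside the filter.\<close>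

definition germ_continuous :: "side \<Rightarrow> (real \<Rightarrow> real) \<Rightarrow> bool" where
  "germ_continuous s f \<longleftrightarrow> (\<exists>\<epsilon>>0. continuous_on (branch_dom s \<epsilon>) f)"

lemma germ_continuous_iff_shrink:
  "germ_continuous s f \<longleftrightarrow> (\<exists>\<epsilon>>0. \<forall>\<delta>. 0 < \<delta> \<and> \<delta> \<le> \<epsilon> \<longrightarrow> continuous_on (branch_dom s \<delta>) f)"
proof -
  have "branch_dom s \<delta> \<subseteq> branch_dom s \<epsilon>" if "\<delta> \<le> \<epsilon>" for \<delta> \<epsilon>
    using that by (auto simp: mem_branch_dom_iff)
  then show ?thesis
    unfolding germ_continuous_def by (meson continuous_on_subset order_refl)
qed

lemma germ_continuous_uniform:
  assumes "\<And>i. i < n \<Longrightarrow> germ_continuous s (f i)"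
  shows "\<exists>\<epsilon>>0. \<forall>\<delta>. 0 < \<delta> \<and> \<delta> \<le> \<epsilon> \<longrightarrow> (\<forall>i<(n::nat). continuous_on (branch_dom s \<delta>) (f i))"
  using assms
proof (induction n)
  case 0
  show ?case by (intro exI[of _ 1]) auto
next
  case (Suc n)
  then obtain \<epsilon>1 \<epsilon>2 where "\<epsilon>1 > 0" "\<epsilon>2 > 0"
    and "\<And>\<delta>. 0 < \<delta> \<and> \<delta> \<le> \<epsilon>1 \<Longrightarrow> \<forall>i<n. continuous_on (branch_dom s \<delta>) (f i)"
    and "\<And>\<delta>. 0 < \<delta> \<and> \<delta> \<le> \<epsilon>2 \<Longrightarrow> continuous_on (branch_dom s \<delta>) (f n)"
    using germ_continuous_iff_shrink[of s "f n"] by (metis less_Suc_eq)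
  then show ?case by (intro exI[of _ "min \<epsilon>1 \<epsilon>2"]) (auto simp: less_Suc_eq)
qed

lemma germ_continuous_small:
  assumes "germ_continuous s f" "f 0 = 0" "r > 0"
  shows "\<forall>\<^sub>F l in germ_filter s. \<bar>f l\<bar> \<le> r"
proof -
  obtain \<epsilon> where \<epsilon>: "\<epsilon> > 0" "continuous_on (branch_dom s \<epsilon>) f"
    using assms(1) by (auto simp: germ_continuous_def)
  have "0 \<in> branch_dom s \<epsilon>"
    using \<epsilon>(1) by (simp add: mem_branch_dom_iff)
  then obtain d where "d > 0" "\<And>l. l \<in> branch_dom s \<epsilon> \<Longrightarrow> dist l 0 < d \<Longrightarrow> dist (f l) (f 0) < r"
    using \<epsilon>(2) assms(3) unfolding continuous_on_iff by meson
  then show ?thesis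
    unfolding eventually_germ_filter using \<epsilon>(1) assms(2)
    by (intro exI[of _ "min d \<epsilon>"]) (force simp: mem_branch_dom_iff dist_norm)
qed

lemma eventually_all_less:
  fixes n :: nat
  shows "(\<And>i. i < n \<Longrightarrow> eventually (P i) F) \<Longrightarrow> \<forall>\<^sub>F x in F. \<forall>i<n. P i x"
  using eventually_ball_finite[of "{..<n}" "\<lambda>x i. P i x" F] by (auto simp: Ball_def)

text \<open>The common radius dissolves into separate germ conditions; conversely, radii for the
  finitely many components and for the equations are merged by taking a minimum.\<close>

lemma equilibrium_branch_iff:
  "equilibrium_branch n F s b \<longleftrightarrow>
    (\<forall>i<n. germ_continuous s (\<lambda>l. b l $ i)) \<and> b 0 = 0\<^sub>v n \<and>
    (\<forall>\<^sub>F l in germ_filter s. b l \<in> carrier_vec n \<and> F (b l) l = 0\<^sub>v n)"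
  (is "?L \<longleftrightarrow> ?R")
proof
  assume ?R
  then obtain \<epsilon>1 where \<epsilon>1: "\<epsilon>1 > 0"
      "\<And>\<delta>. 0 < \<delta> \<and> \<delta> \<le> \<epsilon>1 \<Longrightarrow> \<forall>i<n. continuous_on (branch_dom s \<delta>) (\<lambda>l. b l $ i)"
    using germ_continuous_uniform[of n s "\<lambda>i l. b l $ i"] by blast
  obtain \<epsilon>2 where \<epsilon>2: "\<epsilon>2 > 0"
      "\<forall>l\<in>branch_dom s \<epsilon>2. b l \<in> carrier_vec n \<and> F (b l) l = 0\<^sub>v n"
    using \<open>?R\<close> unfolding eventually_germ_filter by blast
  show ?L
    unfolding equilibrium_branch_def equilibrium_branch_on_def
    using \<epsilon>1 \<epsilon>2 \<open>?R\<close> by (intro exI[of _ "min \<epsilon>1 \<epsilon>2"]) (auto simp: mem_branch_dom_iff)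
qed (auto simp: equilibrium_branch_def equilibrium_branch_on_def eventually_germ_filter
    germ_continuous_def)

section \<open>Solving the network equations along a germ\<close>

lemma smooth_continuous_on: "smooth f \<Longrightarrow> continuous_on UNIV f"
  unfolding smooth_def by (metis C_times.simps(1))

lemma cell_field_local_inverse_laplacian:
  assumes gh: "smooth g" "smooth h" "diffusive h" and g0: "\<And>l. g (0, l) = 0"
    and W: "W \<in> carrier_mat n n" and h1: "h_deriv h \<noteq> 0"
    and ne: "\<not> laplacian_eigenvalue W (complex_of_real (- g_deriv g / h_deriv h))"
    and w: "w = (\<lambda>i j. W $$ (i, j))"
  shows "\<exists>r>0. \<exists>K>0.
    (\<forall>l x y e. \<bar>l\<bar> \<le> r \<and> (\<forall>i<n. \<bar>x i\<bar> \<le> r \<and> \<bar>y i\<bar> \<le> r \<and>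
        \<bar>cell_field g h n w x l i - cell_field g h n w y l i\<bar> \<le> e) \<longrightarrow>
      (\<forall>i<n. \<bar>x i - y i\<bar> \<le> K * e)) \<and>
    (\<forall>l y. \<bar>l\<bar> \<le> r \<and> (\<forall>i<n. \<bar>y i\<bar> \<le> r / K) \<longrightarrow>
      (\<exists>x. \<forall>i<n. \<bar>x i\<bar> \<le> r \<and> cell_field g h n w x l i = y i))"
proof (rule cell_lin_inverse[OF W h1 ne])
  fix B
  assume "\<And>d i. i < n \<Longrightarrow>
      (\<Sum>j<n. B i j * cell_lin (g_deriv g) (h_deriv h) n (\<lambda>i j. W $$ (i, j)) d j) = d i"
    and "\<And>e j. (\<And>i. i < n \<Longrightarrow> (\<Sum>j<n. B i j * e j) = 0) \<Longrightarrow> j < n \<Longrightarrow> e j = (0::real)"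
  then show ?thesis
    unfolding w by (rule cell_field_local_inverse[OF gh g0])
qed

lemma cell_field_locally_injective:
  assumes "smooth g" "smooth h" "diffusive h" "\<And>l. g (0, l) = 0"
    and "W \<in> carrier_mat n n" "h_deriv h \<noteq> 0"
    and "\<not> laplacian_eigenvalue W (complex_of_real (- g_deriv g / h_deriv h))"
    and w: "w = (\<lambda>i j. W $$ (i, j))"
  shows "\<exists>r>0. \<forall>l x y. \<bar>l\<bar> \<le> r \<and> (\<forall>i<n. \<bar>x i\<bar> \<le> r \<and> \<bar>y i\<bar> \<le> r \<and>
        cell_field g h n w x l i = cell_field g h n w y l i) \<longrightarrow> (\<forall>i<n. x i = y i)"
proof -
  obtain r K where r: "r > 0" and
    K: "\<forall>l x y e. \<bar>l\<bar> \<le> r \<and> (\<forall>i<n. \<bar>x i\<bar> \<le> r \<and> \<bar>y i\<bar> \<le> r \<and>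
        \<bar>cell_field g h n w x l i - cell_field g h n w y l i\<bar> \<le> e) \<longrightarrow>
      (\<forall>i<n. \<bar>x i - y i\<bar> \<le> K * e)"
    using cell_field_local_inverse_laplacian[OF assms] by blast
  have "\<forall>i<n. x i = y i" if "\<bar>l\<bar> \<le> r \<and> (\<forall>i<n. \<bar>x i\<bar> \<le> r \<and> \<bar>y i\<bar> \<le> r \<and>
        cell_field g h n w x l i = cell_field g h n w y l i)" for l x y
    using K[rule_format, of l x y 0] that by simp
  with r show ?thesis by blast
qed

text \<open>Solutions are chosen separately for each parameter. Their continuity comes from the
  Lipschitz bound for the inverse, applied at one parameter to the states \<open>x l\<close> and
  \<open>x l0\<close>.\<close>

lemma cell_field_solve_along_germ:
  assumes gh: "smooth g" "smooth h" "diffusive h" and g0: "\<And>l. g (0, l) = 0"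
    and W: "W \<in> carrier_mat n n" "h_deriv h \<noteq> 0"
      "\<not> laplacian_eigenvalue W (complex_of_real (- g_deriv g / h_deriv h))"
    and w: "w = (\<lambda>i j. W $$ (i, j))"
    and y: "\<And>j. j < n \<Longrightarrow> germ_continuous s (\<lambda>l. y l j)" "\<And>j. j < n \<Longrightarrow> y 0 j = 0"
  shows "\<exists>x. (\<forall>i<n. germ_continuous s (\<lambda>l. x l i) \<and> x 0 i = 0) \<and>
    (\<forall>\<^sub>F l in germ_filter s. \<forall>i<n. cell_field g h n w (x l) l i = y l i)"
proof -
  let ?F = "\<lambda>x l. cell_field g h n w x l"
  obtain r K where r: "r > 0" and K: "K > 0" and
    lip: "\<forall>l x y e. \<bar>l\<bar> \<le> r \<and> (\<forall>i<n. \<bar>x i\<bar> \<le> r \<and> \<bar>y i\<bar> \<le> r \<and> \<bar>?F x l i - ?F y l i\<bar> \<le> e) \<longrightarrow>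
      (\<forall>i<n. \<bar>x i - y i\<bar> \<le> K * e)" and
    ex: "\<forall>l y. \<bar>l\<bar> \<le> r \<and> (\<forall>i<n. \<bar>y i\<bar> \<le> r / K) \<longrightarrow>
      (\<exists>x. \<forall>i<n. \<bar>x i\<bar> \<le> r \<and> ?F x l i = y i)"
    using cell_field_local_inverse_laplacian[OF gh g0 W w] by blast
  have "\<forall>\<^sub>F l in germ_filter s. \<bar>l\<bar> \<le> r \<and> (\<forall>j<n. \<bar>y l j\<bar> \<le> r / K)"
    using r K y
    by (intro eventually_conj eventually_germ_filter_abs_le eventually_all_less germ_continuous_small)
      auto
  then obtain \<epsilon>1 where \<epsilon>1: "\<epsilon>1 > 0"
      "\<forall>l\<in>branch_dom s \<epsilon>1. \<bar>l\<bar> \<le> r \<and> (\<forall>j<n. \<bar>y l j\<bar> \<le> r / K)"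
    unfolding eventually_germ_filter by blast
  obtain \<epsilon>2 where \<epsilon>2: "\<epsilon>2 > 0"
      "\<And>\<delta>. 0 < \<delta> \<and> \<delta> \<le> \<epsilon>2 \<Longrightarrow> \<forall>j<n. continuous_on (branch_dom s \<delta>) (\<lambda>l. y l j)"
    using germ_continuous_uniform[of n s "\<lambda>j l. y l j"] y(1) by blast
  define D where "D = branch_dom s (min \<epsilon>1 \<epsilon>2)"
  have "0 \<in> D"
    using \<epsilon>1 \<epsilon>2 by (simp add: D_def mem_branch_dom_iff)
  have D1: "\<bar>l\<bar> \<le> r" "\<forall>j<n. \<bar>y l j\<bar> \<le> r / K" if "l \<in> D" for l
    using \<epsilon>1(2) that by (auto simp: D_def mem_branch_dom_iff)
  have D2: "continuous_on D (\<lambda>l. y l j)" if "j < n" for j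
    unfolding D_def using \<epsilon>1(1) \<epsilon>2 that by simp
  have "\<forall>l\<in>D. \<exists>x. \<forall>i<n. \<bar>x i\<bar> \<le> r \<and> ?F x l i = y l i"
    using ex D1 by blast
  then obtain x where x: "\<And>l i. l \<in> D \<Longrightarrow> i < n \<Longrightarrow> \<bar>x l i\<bar> \<le> r \<and> ?F (x l) l i = y l i"
    by metis
  have cont: "continuous_on D (\<lambda>l. x l i)" if i: "i < n" for i
    unfolding continuous_on_def
  proof
    fix l0 assume l0: "l0 \<in> D"
    define e where "e l = (\<Sum>j<n. \<bar>y l j - ?F (x l0) l j\<bar>)" for l
    have "continuous_on D e"
      unfolding e_def cell_field_def
      by (intro continuous_intros D2 continuous_on_compose2[OF smooth_continuous_on[OF gh(1)]]
          continuous_on_compose2[OF smooth_continuous_on[OF gh(2)]]) auto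
    then have "(e \<longlongrightarrow> e l0) (at l0 within D)"
      using l0 by (simp add: continuous_on_def)
    moreover have "e l0 = 0"
      using x[OF l0] by (simp add: e_def)
    ultimately have e0: "((\<lambda>l. K * e l) \<longlongrightarrow> 0) (at l0 within D)"
      using tendsto_mult_left[of e 0 "at l0 within D" K] by simp
    have "\<bar>x l i - x l0 i\<bar> \<le> K * e l" if l: "l \<in> D" for l
    proof -
      have "\<bar>?F (x l) l j - ?F (x l0) l j\<bar> \<le> e l" if "j < n" for j
        unfolding e_def using that x[OF l]
          member_le_sum[of j "{..<n}" "\<lambda>j. \<bar>y l j - ?F (x l0) l j\<bar>"] by simp
      then show ?thesis
        using lip[rule_format, of l "x l" "x l0" "e l" i] D1(1)[OF l] x[OF l] x[OF l0] i by simp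
    qed
    then have "\<forall>\<^sub>F l in at l0 within D. norm (x l i - x l0 i) \<le> K * e l"
      by (auto simp: eventually_at_filter)
    from Lim_null_comparison[OF this e0] show "((\<lambda>l. x l i) \<longlongrightarrow> x l0 i) (at l0 within D)"
      using Lim_null by blast
  qed
  have F0: "?F (\<lambda>_. 0) l i = 0" for l i
    using g0 gh(3) by (simp add: cell_field_def diffusive_def)
  \<comment> \<open>At parameter 0 the right-hand side is 0, so the zero state solves the same
    system; the bound with \<open>e = 0\<close> identifies the two.\<close>
  have "x 0 i = 0" if "i < n" for i
    using lip[rule_format, of 0 "x 0" "\<lambda>_. 0" 0 i] x[OF \<open>0 \<in> D\<close>] r y(2) F0 that by simp
  moreover have "germ_continuous s (\<lambda>l. x l i)" if "i < n" for i
    unfolding germ_continuous_def using cont[OF that] \<epsilon>1(1) \<epsilon>2(1)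
    by (intro exI[of _ "min \<epsilon>1 \<epsilon>2"]) (simp add: D_def)
  moreover have "\<forall>\<^sub>F l in germ_filter s. \<forall>i<n. ?F (x l) l i = y l i"
    unfolding eventually_germ_filter using x \<epsilon>1(1) \<epsilon>2(1)
    by (intro exI[of _ "min \<epsilon>1 \<epsilon>2"]) (simp add: D_def)
  ultimately show ?thesis by (intro exI[of _ x]) blast
qed

section \<open>Branches of feedforward coalescence networks\<close>

lemma zero_vec_append3:
  "0 < n1 \<Longrightarrow> 0 < n2 \<Longrightarrow>
    0\<^sub>v (n1 + n2 - 1) = (0\<^sub>v (n1 - 1) @\<^sub>v vec1 0 @\<^sub>v 0\<^sub>v (n2 - 1) :: real vec)"
  by (intro eq_vecI) auto

lemma zero_vec_append_vec1:
  "0 < n \<Longrightarrow> 0\<^sub>v n = (0\<^sub>v (n - 1) @\<^sub>v vec1 0 :: real vec)"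
  by (intro eq_vecI) auto

lemma zero_vec_vec1_append:
  "0 < n \<Longrightarrow> 0\<^sub>v n = (vec1 0 @\<^sub>v 0\<^sub>v (n - 1) :: real vec)"
  by (intro eq_vecI) auto

lemma vec1_eq_iff: "vec1 x = vec1 y \<longleftrightarrow> x = y"
  by (auto simp: vec_eq_iff)

lemma append3_eq_0_iff:
  assumes "0 < n1" "0 < n2" "x1 \<in> carrier_vec (n1 - 1)"
  shows "x1 @\<^sub>v vec1 xc @\<^sub>v x2 = 0\<^sub>v (n1 + n2 - 1) \<longleftrightarrow>
    x1 = 0\<^sub>v (n1 - 1) \<and> xc = 0 \<and> x2 = 0\<^sub>v (n2 - 1)"
  unfolding zero_vec_append3[OF assms(1,2)]
  using assms(3) by (simp add: append_vec_eq[of _ "n1 - 1"] append_vec_eq[of _ 1] vec1_eq_iff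
      del: One_nat_def)

lemma append_vec1_eq_0_iff:
  assumes "0 < n" "x \<in> carrier_vec (n - 1)"
  shows "x @\<^sub>v vec1 y = 0\<^sub>v n \<longleftrightarrow> x = 0\<^sub>v (n - 1) \<and> y = 0"
  unfolding zero_vec_append_vec1[OF assms(1)]
  using assms(2) by (simp add: append_vec_eq[of _ "n - 1"] vec1_eq_iff
      del: One_nat_def)

lemma vec1_append_eq_0_iff:
  assumes "0 < n"
  shows "vec1 y @\<^sub>v x = 0\<^sub>v n \<longleftrightarrow> y = 0 \<and> x = 0\<^sub>v (n - 1)"
  unfolding zero_vec_vec1_append[OF assms]
  by (simp add: append_vec_eq[of _ 1] vec1_eq_iff
      del: One_nat_def)

text \<open>The equations of the second network away from the cell \<open>c\<close>, for a prescribed state of \<open>c\<close>.\<close>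

definition tail_branch ::
    "(real \<times> real \<Rightarrow> real) \<Rightarrow> (real \<times> real \<times> real \<Rightarrow> real) \<Rightarrow> real mat \<Rightarrow> nat \<Rightarrow> side \<Rightarrow>
     (real \<Rightarrow> real) \<Rightarrow> (real \<Rightarrow> real vec) \<Rightarrow> bool" where
  "tail_branch g h W n s bc b \<longleftrightarrow>
    (\<forall>i<n - 1. germ_continuous s (\<lambda>l. b l $ i)) \<and> b 0 = 0\<^sub>v (n - 1) \<and>
    (\<forall>\<^sub>F l in germ_filter s.
      \<forall>i. 0 < i \<and> i < n \<longrightarrow> admissible g h W (vec1 (bc l) @\<^sub>v b l) l $ i = 0)"

section \<open>Splitting of branches along the feedforward structure\<close>

locale feedforward_system =
  fixes g :: "real \<times> real \<Rightarrow> real" and h :: "real \<times> real \<times> real \<Rightarrow> real"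
    and W1 W2 :: "real mat" and n1 n2 :: nat
  assumes FF: "feedforward_coalescence n1 n2 W1 W2"
    and smooth_g: "smooth g" and smooth_h: "smooth h"
    and diffusive: "diffusive h"
    and g_0: "\<And>l. g (0, l) = 0"
begin

lemmas car = feedforward_coalescence_carrier[OF FF]

lemma admissible_0:
  assumes "W \<in> carrier_mat n n"
  shows "admissible g h W (0\<^sub>v n) l = 0\<^sub>v n"
  using assms diffusive g_0 by (intro eq_vecI) (auto simp: admissible_def diffusive_def)

lemma equilibrium_branch_coalescence_iff:
  assumes b1: "b1 \<in> UNIV \<rightarrow> carrier_vec (n1 - 1)" and b2: "b2 \<in> UNIV \<rightarrow> carrier_vec (n2 - 1)"
  shows "equilibrium_branch (n1 + n2 - 1) (admissible g h (coalescence W1 W2)) s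
      (\<lambda>l. b1 l @\<^sub>v vec1 (bc l) @\<^sub>v b2 l) \<longleftrightarrow>
    equilibrium_branch n1 (admissible g h W1) s (\<lambda>l. b1 l @\<^sub>v vec1 (bc l)) \<and>
    tail_branch g h W2 n2 s bc b2"
proof -
  have c1: "b1 l \<in> carrier_vec (n1 - 1)" and c2: "b2 l \<in> carrier_vec (n2 - 1)" for l
    using b1 b2 by auto
  then have d1: "dim_vec (b1 l) = n1 - 1" and d2: "dim_vec (b2 l) = n2 - 1" for l
    by (simp_all add: carrier_vecD)
  have cN: "b1 l @\<^sub>v vec1 (bc l) @\<^sub>v b2 l \<in> carrier_vec (n1 + n2 - 1)"
    and cN1: "b1 l @\<^sub>v vec1 (bc l) \<in> carrier_vec n1" for l
    using car(3,4) by (auto simp: d1 d2 intro!: carrier_vecI)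
  have 1: "(b1 l @\<^sub>v vec1 (bc l) @\<^sub>v b2 l) $ i = (b1 l @\<^sub>v vec1 (bc l)) $ i" if "i < n1" for i l
    using that car(3,4) by (simp add: d1 d2)
  \<comment> \<open>Blocks of lengths \<open>n1 - 1\<close> and 1 precede \<open>b2\<close>, so its
    entries start at index \<open>n1\<close>.\<close>
  have 2: "(b1 l @\<^sub>v vec1 (bc l) @\<^sub>v b2 l) $ (n1 + i) = b2 l $ i" if "i < n2 - 1" for i l
    using that car(3,4) by (auto simp: d1 d2)
  have "(\<forall>i<n1 + n2 - 1. germ_continuous s (\<lambda>l. (b1 l @\<^sub>v vec1 (bc l) @\<^sub>v b2 l) $ i)) \<longleftrightarrow>
      (\<forall>i<n1. germ_continuous s (\<lambda>l. (b1 l @\<^sub>v vec1 (bc l) @\<^sub>v b2 l) $ i)) \<and>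
      (\<forall>i<n2 - 1. germ_continuous s (\<lambda>l. (b1 l @\<^sub>v vec1 (bc l) @\<^sub>v b2 l) $ (n1 + i)))"
    (is "(\<forall>i<_. ?P i) \<longleftrightarrow> _")
  proof (intro iffI conjI allI impI)
    fix i assume A: "(\<forall>i<n1. ?P i) \<and> (\<forall>i<n2 - 1. ?P (n1 + i))" and "i < n1 + n2 - 1"
    then consider "i < n1" | "i = n1 + (i - n1)" "i - n1 < n2 - 1" by linarith
    then show "?P i" using A by cases metis+
  qed (use car(3,4) in auto)
  then have cont: "(\<forall>i<n1 + n2 - 1. germ_continuous s (\<lambda>l. (b1 l @\<^sub>v vec1 (bc l) @\<^sub>v b2 l) $ i)) \<longleftrightarrow>
      (\<forall>i<n1. germ_continuous s (\<lambda>l. (b1 l @\<^sub>v vec1 (bc l)) $ i)) \<and>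
      (\<forall>i<n2 - 1. germ_continuous s (\<lambda>l. b2 l $ i))"
    by (simp only: 1 2 cong: all_cong)
  show ?thesis
    unfolding equilibrium_branch_iff tail_branch_def cont
      append3_eq_0_iff[OF car(3,4) c1] append_vec1_eq_0_iff[OF car(3) c1]
      admissible_coalescence_eq_0_iff[OF FF diffusive c1 c2]
    using cN cN1 by (auto simp: eventually_conj_iff)
qed

lemma admissible_snd_0:
  "admissible g h W2 (vec1 x @\<^sub>v v) l $ 0 = g (x, l)"
  using feedforward_cell_field_0[OF FF diffusive] car
  by (simp add: admissible_eq_cell_field[OF car(2)])

text \<open>Row 0 reduces to \<open>g\<close>, so a branch of the second network is a tail branch
  over a zero of \<open>g\<close>. Within the coalescence the same tail is driven by the last
  component of a branch of the first network instead.\<close>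

lemma equilibrium_branch_snd_iff:
  assumes b2: "b2 \<in> UNIV \<rightarrow> carrier_vec (n2 - 1)"
  shows "equilibrium_branch n2 (admissible g h W2) s (\<lambda>l. vec1 (bc l) @\<^sub>v b2 l) \<longleftrightarrow>
    germ_continuous s bc \<and> bc 0 = 0 \<and> (\<forall>\<^sub>F l in germ_filter s. g (bc l, l) = 0) \<and>
    tail_branch g h W2 n2 s bc b2"
proof -
  have c2: "b2 l \<in> carrier_vec (n2 - 1)" for l
    using b2 by auto
  then have d2: "dim_vec (b2 l) = n2 - 1" for l
    by (simp add: carrier_vecD)
  have cN2: "vec1 (bc l) @\<^sub>v b2 l \<in> carrier_vec n2" for l
    using car(4) by (auto simp: d2 intro!: carrier_vecI)
  have all: "(\<forall>i<n2. P i) \<longleftrightarrow> P 0 \<and> (\<forall>i<n2 - 1. P (Suc i))" for P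
    using car(4) by (cases n2) (auto simp: All_less_Suc2)
  have all': "(\<forall>i<n2. P i) \<longleftrightarrow> P 0 \<and> (\<forall>i. 0 < i \<and> i < n2 \<longrightarrow> P i)" for P
    using car(4) by (metis gr0I)
  have "(vec1 (bc l) @\<^sub>v b2 l) $ Suc i = b2 l $ i" if "i < n2 - 1" for i l
    using that by (simp add: d2)
  moreover have "(vec1 (bc l) @\<^sub>v b2 l) $ 0 = bc l" for l
    by simp
  ultimately have cont: "(\<forall>i<n2. germ_continuous s (\<lambda>l. (vec1 (bc l) @\<^sub>v b2 l) $ i)) \<longleftrightarrow>
      germ_continuous s bc \<and> (\<forall>i<n2 - 1. germ_continuous s (\<lambda>l. b2 l $ i))"
    unfolding all by simp
  have "admissible g h W2 (vec1 (bc l) @\<^sub>v b2 l) l = 0\<^sub>v n2 \<longleftrightarrow>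
      (\<forall>i<n2. admissible g h W2 (vec1 (bc l) @\<^sub>v b2 l) l $ i = 0)" for l
    using car by (auto simp: vec_eq_iff admissible_def)
  then have eq0: "admissible g h W2 (vec1 (bc l) @\<^sub>v b2 l) l = 0\<^sub>v n2 \<longleftrightarrow>
      g (bc l, l) = 0 \<and>
      (\<forall>i. 0 < i \<and> i < n2 \<longrightarrow> admissible g h W2 (vec1 (bc l) @\<^sub>v b2 l) l $ i = 0)" for l
    unfolding all' admissible_snd_0 by blast
  show ?thesis
    unfolding equilibrium_branch_iff tail_branch_def cont vec1_append_eq_0_iff[OF car(4)] eq0
    using cN2 by (auto simp: eventually_conj_iff)
qed

lemma equilibrium_branch_fst_last:
  assumes b1: "b1 \<in> UNIV \<rightarrow> carrier_vec (n1 - 1)"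
    and "equilibrium_branch n1 (admissible g h W1) s (\<lambda>l. b1 l @\<^sub>v vec1 (bc l))"
  shows "germ_continuous s bc" "bc 0 = 0"
proof -
  have c1: "b1 l \<in> carrier_vec (n1 - 1)" for l
    using b1 by auto
  have "(b1 l @\<^sub>v vec1 (bc l)) $ (n1 - 1) = bc l" for l
    using carrier_vecD[OF c1[of l]] by simp
  moreover have "n1 - 1 < n1" using car by simp
  ultimately show "germ_continuous s bc"
    using assms(2) unfolding equilibrium_branch_iff by fastforce
  show "bc 0 = 0"
    using assms(2) unfolding equilibrium_branch_iff append_vec1_eq_0_iff[OF car(3) c1] by blast
qed

section \<open>Existence and uniqueness of completions\<close>

text \<open>Strict differentiability with error at most half the slope: equal values force
  \<open>|a - b|\<close> times the slope to be at most half of itself.\<close>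

lemma g_locally_injective:
  assumes "g_deriv g \<noteq> 0"
  shows "\<exists>r>0. \<forall>a b l. \<bar>a\<bar> \<le> r \<longrightarrow> \<bar>b\<bar> \<le> r \<longrightarrow> \<bar>l\<bar> \<le> r \<longrightarrow> g (a, l) = g (b, l) \<longrightarrow> a = b"
proof -
  obtain r where r: "r > 0" "\<forall>a b l. \<bar>a\<bar> \<le> r \<longrightarrow> \<bar>b\<bar> \<le> r \<longrightarrow> \<bar>l\<bar> \<le> r \<longrightarrow>
      \<bar>g (a, l) - g (b, l) - g_deriv g * (a - b)\<bar> \<le> \<bar>g_deriv g\<bar> / 2 * \<bar>a - b\<bar>"
    using internal_dynamics_strictly_differentiable[OF smooth_g, of "\<bar>g_deriv g\<bar> / 2"] assms by auto
  have "a = b" if "\<bar>a\<bar> \<le> r" "\<bar>b\<bar> \<le> r" "\<bar>l\<bar> \<le> r" "g (a, l) = g (b, l)" for a b l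
  proof -
    have "\<bar>g_deriv g\<bar> * \<bar>a - b\<bar> \<le> \<bar>g_deriv g\<bar> / 2 * \<bar>a - b\<bar>"
      using r(2)[rule_format, of a b l] that by (simp add: abs_mult)
    then have "\<bar>g_deriv g\<bar> * \<bar>a - b\<bar> \<le> 0" by simp
    with assms show ?thesis by (simp add: mult_le_0_iff)
  qed
  with r(1) show ?thesis by blast
qed

lemma germs_eq_of_g_eq:
  assumes "g_deriv g \<noteq> 0"
    and "germ_continuous s b" "b 0 = 0" "germ_continuous s b'" "b' 0 = 0"
    and "\<forall>\<^sub>F l in germ_filter s. g (b l, l) = g (b' l, l)"
  shows "\<forall>\<^sub>F l in germ_filter s. b l = b' l"
proof -
  obtain r where r: "r > 0"
    "\<forall>a b l. \<bar>a\<bar> \<le> r \<longrightarrow> \<bar>b\<bar> \<le> r \<longrightarrow> \<bar>l\<bar> \<le> r \<longrightarrow> g (a, l) = g (b, l) \<longrightarrow> a = b"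
    using g_locally_injective[OF assms(1)] by blast
  show ?thesis
    using eventually_germ_filter_abs_le[OF r(1)] germ_continuous_small[OF assms(2,3) r(1)]
      germ_continuous_small[OF assms(4,5) r(1)] assms(6)
    by eventually_elim (use r(2) in blast)
qed

lemma tail_branch_exists:
  assumes h1: "h_deriv h \<noteq> 0" and g0: "g_deriv g \<noteq> 0"
    and ne: "\<not> laplacian_eigenvalue W2 (complex_of_real (- g_deriv g / h_deriv h))"
    and bc: "germ_continuous s bc" "bc 0 = 0"
  shows "\<exists>b2 \<in> UNIV \<rightarrow> carrier_vec (n2 - 1). tail_branch g h W2 n2 s bc b2"
proof -
  let ?w = "\<lambda>i j. W2 $$ (i, j)"
  \<comment> \<open>Row \<open>0\<close> of the system is \<open>g (x\<^sub>0, l)\<close>; prescribing it makes the full Jacobian available.\<close>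
  define y where "y l j = (if j = 0 then g (bc l, l) else 0)" for l and j :: nat
  obtain \<epsilon> where "\<epsilon> > 0" "continuous_on (branch_dom s \<epsilon>) bc"
    using bc(1) unfolding germ_continuous_def by blast
  then have "continuous_on (branch_dom s \<epsilon>) (\<lambda>l. g (bc l, l))"
    by (intro continuous_on_compose2[OF smooth_continuous_on[OF smooth_g]] continuous_intros) auto
  with \<open>\<epsilon> > 0\<close> have "germ_continuous s (\<lambda>l. y l j)" for j
    unfolding germ_continuous_def y_def by (cases "j = 0") auto
  moreover have "y 0 j = 0" for j
    using bc(2) g_0 by (simp add: y_def)
  ultimately obtain x where x: "\<forall>i<n2. germ_continuous s (\<lambda>l. x l i) \<and> x 0 i = 0"
    and Fx: "\<forall>\<^sub>F l in germ_filter s. \<forall>i<n2. cell_field g h n2 ?w (x l) l i = y l i"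
    using cell_field_solve_along_germ[OF smooth_g smooth_h diffusive g_0 car(2) h1 ne refl,
        where s = s and y = y] by blast
  \<comment> \<open>Row 0 only equates values of \<open>g\<close>; since \<open>g_deriv g\<close> is
    non-zero and both germs are small, the solved state of \<open>c\<close> is the prescribed one.
    The remaining entries then form the tail.\<close>
  have "\<forall>\<^sub>F l in germ_filter s. g (x l 0, l) = g (bc l, l)"
    using Fx by eventually_elim
      (use car(4) feedforward_cell_field_0[OF FF diffusive] in \<open>auto simp: y_def\<close>)
  then have x0: "\<forall>\<^sub>F l in germ_filter s. x l 0 = bc l"
    using germs_eq_of_g_eq[OF g0, of s "\<lambda>l. x l 0" bc] x car(4) bc by simp
  define b2 where "b2 l = vec (n2 - 1) (\<lambda>i. x l (Suc i))" for l
  have "\<forall>\<^sub>F l in germ_filter s.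
      \<forall>i. 0 < i \<and> i < n2 \<longrightarrow> admissible g h W2 (vec1 (bc l) @\<^sub>v b2 l) l $ i = 0"
    using Fx x0
  proof eventually_elim
    case (elim l)
    have "(vec1 (bc l) @\<^sub>v b2 l) $ i = x l i" if "i < n2" for i
      using that elim(2) by (cases i) (auto simp: b2_def)
    then have "admissible g h W2 (vec1 (bc l) @\<^sub>v b2 l) l $ i = cell_field g h n2 ?w (x l) l i"
      if "i < n2" for i
      using that by (simp add: admissible_eq_cell_field[OF car(2)] cong: cell_field_cong)
    with elim(1) show ?case by (simp add: y_def)
  qed
  then have "tail_branch g h W2 n2 s bc b2"
    unfolding tail_branch_def using x by (auto simp: b2_def)
  then show ?thesis
    by (intro bexI[of _ b2]) (auto simp: b2_def)
qed

lemma tail_branch_small: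
  assumes "tail_branch g h W2 n2 s bc b2" "germ_continuous s bc" "bc 0 = 0"
    and b2: "b2 \<in> UNIV \<rightarrow> carrier_vec (n2 - 1)" and "r > 0"
  shows "\<forall>\<^sub>F l in germ_filter s. \<forall>i<n2. \<bar>(vec1 (bc l) @\<^sub>v b2 l) $ i\<bar> \<le> r"
proof (rule eventually_all_less)
  have c2: "b2 l \<in> carrier_vec (n2 - 1)" for l
    using b2 by auto
  fix i assume i: "i < n2"
  show "\<forall>\<^sub>F l in germ_filter s. \<bar>(vec1 (bc l) @\<^sub>v b2 l) $ i\<bar> \<le> r"
  proof (cases i)
    case 0
    then show ?thesis using germ_continuous_small[OF assms(2,3,5)] by simp
  next
    case (Suc j)
    then have "\<forall>\<^sub>F l in germ_filter s. \<bar>b2 l $ j\<bar> \<le> r"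
      using assms(1) i \<open>r > 0\<close> unfolding tail_branch_def by (intro germ_continuous_small) auto
    moreover have "(vec1 (bc l) @\<^sub>v b2 l) $ i = b2 l $ j" for l
      using carrier_vecD[OF c2[of l]] Suc i by simp
    ultimately show ?thesis by simp
  qed
qed

text \<open>Completed by the state of \<open>c\<close>, both tails give the same value of the whole
  field: 0 in the rows after \<open>c\<close>, and the same value of \<open>g\<close> in row 0.
  Local injectivity of the second network applies. Allowing \<open>bc\<close> and \<open>bc'\<close>
  to agree merely as germs permits comparison with the zero branch.\<close>

lemma tail_branch_unique:
  assumes h1: "h_deriv h \<noteq> 0"
    and ne: "\<not> laplacian_eigenvalue W2 (complex_of_real (- g_deriv g / h_deriv h))"
    and bc: "germ_continuous s bc" "bc 0 = 0" and bc': "germ_continuous s bc'" "bc' 0 = 0"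
    and b2: "b2 \<in> UNIV \<rightarrow> carrier_vec (n2 - 1)" and b2': "b2' \<in> UNIV \<rightarrow> carrier_vec (n2 - 1)"
    and t: "tail_branch g h W2 n2 s bc b2" and t': "tail_branch g h W2 n2 s bc' b2'"
    and eq: "\<forall>\<^sub>F l in germ_filter s. bc l = bc' l"
  shows "germ_eq s b2 b2'"
proof -
  let ?w = "\<lambda>i j. W2 $$ (i, j)"
  obtain r where r: "r > 0" and inj: "\<forall>l x y. \<bar>l\<bar> \<le> r \<and> (\<forall>i<n2. \<bar>x i\<bar> \<le> r \<and> \<bar>y i\<bar> \<le> r \<and>
        cell_field g h n2 ?w x l i = cell_field g h n2 ?w y l i) \<longrightarrow> (\<forall>i<n2. x i = y i)"
    using cell_field_locally_injective[OF smooth_g smooth_h diffusive g_0 car(2) h1 ne refl] by blast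
  have rows: "\<forall>\<^sub>F l in germ_filter s.
      \<forall>i. 0 < i \<and> i < n2 \<longrightarrow> admissible g h W2 (vec1 (bc l) @\<^sub>v b2 l) l $ i = 0"
    "\<forall>\<^sub>F l in germ_filter s.
      \<forall>i. 0 < i \<and> i < n2 \<longrightarrow> admissible g h W2 (vec1 (bc' l) @\<^sub>v b2' l) l $ i = 0"
    using t t' by (auto simp: tail_branch_def)
  show ?thesis
    unfolding germ_eq_iff_eventually
    using eventually_germ_filter_abs_le[OF r] tail_branch_small[OF t bc b2 r]
      tail_branch_small[OF t' bc' b2' r] rows eq
  proof eventually_elim
    case (elim l)
    let ?x = "vec1 (bc l) @\<^sub>v b2 l" and ?y = "vec1 (bc' l) @\<^sub>v b2' l"
    have "admissible g h W2 ?x l $ i = admissible g h W2 ?y l $ i" if "i < n2" for i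
      using elim that by (cases "i = 0") (auto simp: admissible_snd_0 simp del: One_nat_def)
    then have "cell_field g h n2 ?w (\<lambda>i. ?x $ i) l i = cell_field g h n2 ?w (\<lambda>i. ?y $ i) l i"
      if "i < n2" for i
      using that by (simp add: admissible_eq_cell_field[OF car(2)])
    then have "\<bar>l\<bar> \<le> r \<and> (\<forall>i<n2. \<bar>?x $ i\<bar> \<le> r \<and> \<bar>?y $ i\<bar> \<le> r \<and>
        cell_field g h n2 ?w (\<lambda>i. ?x $ i) l i = cell_field g h n2 ?w (\<lambda>i. ?y $ i) l i)"
      using elim(1-3) by blast
    then have xy: "\<forall>i<n2. ?x $ i = ?y $ i"
      by (rule inj[THEN spec, THEN spec, THEN spec, THEN mp])
    have c: "b2 l \<in> carrier_vec (n2 - 1)" "b2' l \<in> carrier_vec (n2 - 1)"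
      using b2 b2' by auto
    show "b2 l = b2' l"
    proof (rule eq_vecI)
      fix i assume "i < dim_vec (b2' l)"
      then show "b2 l $ i = b2' l $ i"
        using xy[rule_format, of "Suc i"] carrier_vecD[OF c(1)] carrier_vecD[OF c(2)] by simp
    qed (use c in auto)
  qed
qed

lemma germ_continuous_const: "germ_continuous s (\<lambda>l. a)"
  unfolding germ_continuous_def by (auto intro: exI[of _ 1])

lemma tail_branch_0: "tail_branch g h W2 n2 s (\<lambda>l. 0) (\<lambda>l. 0\<^sub>v (n2 - 1))"
  unfolding tail_branch_def
  by (simp add: germ_continuous_const zero_vec_vec1_append[OF car(4), symmetric]
      admissible_0[OF car(2)] del: One_nat_def)

text \<open>The zero state is an equilibrium at every parameter, and a branch starting at 0 stays
  where the field is injective in the state, so the two coincide.\<close>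

lemma equilibrium_branch_fst_trivial:
  assumes h1: "h_deriv h \<noteq> 0"
    and ne: "\<not> laplacian_eigenvalue W1 (complex_of_real (- g_deriv g / h_deriv h))"
    and b: "equilibrium_branch n1 (admissible g h W1) s b"
  shows "\<forall>\<^sub>F l in germ_filter s. b l = 0\<^sub>v n1"
proof -
  let ?w = "\<lambda>i j. W1 $$ (i, j)"
  obtain r where r: "r > 0" and inj: "\<forall>l x y. \<bar>l\<bar> \<le> r \<and> (\<forall>i<n1. \<bar>x i\<bar> \<le> r \<and> \<bar>y i\<bar> \<le> r \<and>
        cell_field g h n1 ?w x l i = cell_field g h n1 ?w y l i) \<longrightarrow> (\<forall>i<n1. x i = y i)"
    using cell_field_locally_injective[OF smooth_g smooth_h diffusive g_0 car(1) h1 ne refl] by blast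
  have small: "\<forall>\<^sub>F l in germ_filter s. \<forall>i<n1. \<bar>b l $ i\<bar> \<le> r"
    using b r unfolding equilibrium_branch_iff
    by (intro eventually_all_less germ_continuous_small) auto
  have "\<forall>\<^sub>F l in germ_filter s. b l \<in> carrier_vec n1 \<and> admissible g h W1 (b l) l = 0\<^sub>v n1"
    using b unfolding equilibrium_branch_iff by blast
  then show ?thesis
    using eventually_germ_filter_abs_le[OF r] small
  proof eventually_elim
    case (elim l)
    have "cell_field g h n1 ?w (\<lambda>i. b l $ i) l i = cell_field g h n1 ?w (\<lambda>i. 0) l i"
      if "i < n1" for i
      using elim(1) that g_0 diffusive
      by (simp add: admissible_eq_cell_field[OF car(1), symmetric] cell_field_def[of g h n1 ?w "\<lambda>i. 0"]
          diffusive_def)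
    then have "\<bar>l\<bar> \<le> r \<and> (\<forall>i<n1. \<bar>b l $ i\<bar> \<le> r \<and> \<bar>0\<bar> \<le> r \<and>
        cell_field g h n1 ?w (\<lambda>i. b l $ i) l i = cell_field g h n1 ?w (\<lambda>i. 0) l i)"
      using elim(2,3) r by (intro conjI allI impI) auto
    then have "\<forall>i<n1. b l $ i = 0"
      by (rule inj[THEN spec, THEN spec, THEN spec, THEN mp])
    with elim(1) show "b l = 0\<^sub>v n1" by (intro eq_vecI) auto
  qed
qed

section \<open>Correspondence of bifurcation branches\<close>

lemma germ_eq_append3_iff:
  assumes "b1 \<in> UNIV \<rightarrow> carrier_vec (n1 - 1)"
  shows "germ_eq s (\<lambda>l. b1 l @\<^sub>v vec1 (bc l) @\<^sub>v b2 l) (\<lambda>l. 0\<^sub>v (n1 + n2 - 1)) \<longleftrightarrow>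
    germ_eq s b1 (\<lambda>l. 0\<^sub>v (n1 - 1)) \<and> germ_eq s bc (\<lambda>l. 0) \<and> germ_eq s b2 (\<lambda>l. 0\<^sub>v (n2 - 1))"
proof -
  have "b1 l \<in> carrier_vec (n1 - 1)" for l using assms by auto
  from append3_eq_0_iff[OF car(3,4) this] show ?thesis
    by (simp add: germ_eq_iff_eventually eventually_conj_iff)
qed

lemma germ_eq_append_vec1_iff:
  assumes "b1 \<in> UNIV \<rightarrow> carrier_vec (n1 - 1)"
  shows "germ_eq s (\<lambda>l. b1 l @\<^sub>v vec1 (bc l)) (\<lambda>l. 0\<^sub>v n1) \<longleftrightarrow>
    germ_eq s b1 (\<lambda>l. 0\<^sub>v (n1 - 1)) \<and> germ_eq s bc (\<lambda>l. 0)"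
proof -
  have "b1 l \<in> carrier_vec (n1 - 1)" for l using assms by auto
  from append_vec1_eq_0_iff[OF car(3) this] show ?thesis
    by (simp add: germ_eq_iff_eventually eventually_conj_iff)
qed

lemma germ_eq_vec1_append_iff:
  "germ_eq s (\<lambda>l. vec1 (bc l) @\<^sub>v b2 l) (\<lambda>l. 0\<^sub>v n2) \<longleftrightarrow>
    germ_eq s bc (\<lambda>l. 0) \<and> germ_eq s b2 (\<lambda>l. 0\<^sub>v (n2 - 1))"
  using vec1_append_eq_0_iff[OF car(4)] by (simp add: germ_eq_iff_eventually eventually_conj_iff)

text \<open>Completion keeps a non-zero germ non-zero. Conversely a restriction cannot become
  trivial, because over \<open>bc = 0\<close> the zero tail is the only one and the whole branch
  would vanish.\<close>

lemma bifurcation_fst: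
  assumes h1: "h_deriv h \<noteq> 0" and g0: "g_deriv g \<noteq> 0"
    and ne: "\<not> laplacian_eigenvalue W2 (complex_of_real (- g_deriv g / h_deriv h))"
    and b1: "b1 \<in> UNIV \<rightarrow> carrier_vec (n1 - 1)"
  shows "bifurcation_branch n1 (admissible g h W1) s (\<lambda>l. b1 l @\<^sub>v vec1 (bc l)) \<Longrightarrow>
      \<exists>b2 \<in> UNIV \<rightarrow> carrier_vec (n2 - 1).
        bifurcation_branch (n1 + n2 - 1) (admissible g h (coalescence W1 W2)) s
          (\<lambda>l. b1 l @\<^sub>v vec1 (bc l) @\<^sub>v b2 l) \<and>
        (\<forall>b2' \<in> UNIV \<rightarrow> carrier_vec (n2 - 1).
           bifurcation_branch (n1 + n2 - 1) (admissible g h (coalescence W1 W2)) s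
             (\<lambda>l. b1 l @\<^sub>v vec1 (bc l) @\<^sub>v b2' l) \<longrightarrow> germ_eq s b2' b2)"
    and "b2 \<in> UNIV \<rightarrow> carrier_vec (n2 - 1) \<Longrightarrow>
      bifurcation_branch (n1 + n2 - 1) (admissible g h (coalescence W1 W2)) s
        (\<lambda>l. b1 l @\<^sub>v vec1 (bc l) @\<^sub>v b2 l) \<Longrightarrow>
      bifurcation_branch n1 (admissible g h W1) s (\<lambda>l. b1 l @\<^sub>v vec1 (bc l))"
proof -
  assume b: "bifurcation_branch n1 (admissible g h W1) s (\<lambda>l. b1 l @\<^sub>v vec1 (bc l))"
  then have e1: "equilibrium_branch n1 (admissible g h W1) s (\<lambda>l. b1 l @\<^sub>v vec1 (bc l))"
    by (simp add: bifurcation_branch_def)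
  note bc = equilibrium_branch_fst_last[OF b1 e1]
  obtain b2 where b2: "b2 \<in> UNIV \<rightarrow> carrier_vec (n2 - 1)" and t: "tail_branch g h W2 n2 s bc b2"
    using tail_branch_exists[OF h1 g0 ne bc] by blast
  have "bifurcation_branch (n1 + n2 - 1) (admissible g h (coalescence W1 W2)) s
      (\<lambda>l. b1 l @\<^sub>v vec1 (bc l) @\<^sub>v b2 l)"
    using b e1 t unfolding bifurcation_branch_def equilibrium_branch_coalescence_iff[OF b1 b2]
      germ_eq_append3_iff[OF b1] germ_eq_append_vec1_iff[OF b1] by blast
  moreover have "germ_eq s b2' b2" if b2': "b2' \<in> UNIV \<rightarrow> carrier_vec (n2 - 1)"
    and "bifurcation_branch (n1 + n2 - 1) (admissible g h (coalescence W1 W2)) s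
             (\<lambda>l. b1 l @\<^sub>v vec1 (bc l) @\<^sub>v b2' l)" for b2'
  proof -
    have "tail_branch g h W2 n2 s bc b2'"
      using that(2) unfolding bifurcation_branch_def equilibrium_branch_coalescence_iff[OF b1 b2']
      by blast
    then show ?thesis
      by (rule tail_branch_unique[OF h1 ne bc bc b2' b2 _ t]) simp
  qed
  ultimately show "\<exists>b2 \<in> UNIV \<rightarrow> carrier_vec (n2 - 1).
        bifurcation_branch (n1 + n2 - 1) (admissible g h (coalescence W1 W2)) s
          (\<lambda>l. b1 l @\<^sub>v vec1 (bc l) @\<^sub>v b2 l) \<and>
        (\<forall>b2' \<in> UNIV \<rightarrow> carrier_vec (n2 - 1).
           bifurcation_branch (n1 + n2 - 1) (admissible g h (coalescence W1 W2)) s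
             (\<lambda>l. b1 l @\<^sub>v vec1 (bc l) @\<^sub>v b2' l) \<longrightarrow> germ_eq s b2' b2)"
    using b2 by blast
next
  assume b2: "b2 \<in> UNIV \<rightarrow> carrier_vec (n2 - 1)"
    and b: "bifurcation_branch (n1 + n2 - 1) (admissible g h (coalescence W1 W2)) s
        (\<lambda>l. b1 l @\<^sub>v vec1 (bc l) @\<^sub>v b2 l)"
  then have e1: "equilibrium_branch n1 (admissible g h W1) s (\<lambda>l. b1 l @\<^sub>v vec1 (bc l))"
    and t: "tail_branch g h W2 n2 s bc b2"
    unfolding bifurcation_branch_def equilibrium_branch_coalescence_iff[OF b1 b2] by blast+
  note bc = equilibrium_branch_fst_last[OF b1 e1]
  have "germ_eq s b2 (\<lambda>l. 0\<^sub>v (n2 - 1))" if "germ_eq s bc (\<lambda>l. 0)"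
    using that unfolding germ_eq_iff_eventually[of s bc]
    by (intro tail_branch_unique[OF h1 ne bc germ_continuous_const refl b2 _ t tail_branch_0]) auto
  then show "bifurcation_branch n1 (admissible g h W1) s (\<lambda>l. b1 l @\<^sub>v vec1 (bc l))"
    using b e1 unfolding bifurcation_branch_def germ_eq_append3_iff[OF b1]
      germ_eq_append_vec1_iff[OF b1] by blast
qed

text \<open>Any branch of the coalescence has \<open>b1 = 0\<close> and \<open>bc = 0\<close> as
  germs, since the first network admits only the trivial branch. All nontriviality therefore sits in
  \<open>b2\<close>, which is shared with the second network.\<close>

lemma bifurcation_snd:
  assumes h1: "h_deriv h \<noteq> 0" and g0: "g_deriv g \<noteq> 0"
    and ne: "\<not> laplacian_eigenvalue W1 (complex_of_real (- g_deriv g / h_deriv h))"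
    and b2: "b2 \<in> UNIV \<rightarrow> carrier_vec (n2 - 1)"
  shows "bifurcation_branch n2 (admissible g h W2) s (\<lambda>l. vec1 (bc l) @\<^sub>v b2 l) \<Longrightarrow>
      \<exists>b1 \<in> UNIV \<rightarrow> carrier_vec (n1 - 1).
        bifurcation_branch (n1 + n2 - 1) (admissible g h (coalescence W1 W2)) s
          (\<lambda>l. b1 l @\<^sub>v vec1 (bc l) @\<^sub>v b2 l) \<and>
        (\<forall>b1' \<in> UNIV \<rightarrow> carrier_vec (n1 - 1).
           bifurcation_branch (n1 + n2 - 1) (admissible g h (coalescence W1 W2)) s
             (\<lambda>l. b1' l @\<^sub>v vec1 (bc l) @\<^sub>v b2 l) \<longrightarrow> germ_eq s b1' b1)"
    and "b1 \<in> UNIV \<rightarrow> carrier_vec (n1 - 1) \<Longrightarrow>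
      bifurcation_branch (n1 + n2 - 1) (admissible g h (coalescence W1 W2)) s
        (\<lambda>l. b1 l @\<^sub>v vec1 (bc l) @\<^sub>v b2 l) \<Longrightarrow>
      bifurcation_branch n2 (admissible g h W2) s (\<lambda>l. vec1 (bc l) @\<^sub>v b2 l)"
proof -
  have zero: "germ_eq s b1 (\<lambda>l. 0\<^sub>v (n1 - 1)) \<and> germ_eq s bc (\<lambda>l. 0)"
    if b1: "b1 \<in> UNIV \<rightarrow> carrier_vec (n1 - 1)"
      and "equilibrium_branch n1 (admissible g h W1) s (\<lambda>l. b1 l @\<^sub>v vec1 (bc l))"
      for b1 :: "real \<Rightarrow> real vec"
  proof -
    have "germ_eq s (\<lambda>l. b1 l @\<^sub>v vec1 (bc l)) (\<lambda>l. 0\<^sub>v n1)"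
      using equilibrium_branch_fst_trivial[OF h1 ne that(2)] by (simp only: germ_eq_iff_eventually)
    then show ?thesis
      by (simp only: germ_eq_append_vec1_iff[OF b1])
  qed
  {
    assume b: "bifurcation_branch n2 (admissible g h W2) s (\<lambda>l. vec1 (bc l) @\<^sub>v b2 l)"
    then have bc: "germ_continuous s bc" "bc 0 = 0"
      and g: "\<forall>\<^sub>F l in germ_filter s. g (bc l, l) = 0"
      and t: "tail_branch g h W2 n2 s bc b2"
      unfolding bifurcation_branch_def equilibrium_branch_snd_iff[OF b2] by blast+
    have bc0: "\<forall>\<^sub>F l in germ_filter s. bc l = 0"
      using germs_eq_of_g_eq[OF g0 bc germ_continuous_const refl] g g_0 by simp
    define b1 :: "real \<Rightarrow> real vec" where "b1 = (\<lambda>l. 0\<^sub>v (n1 - 1))"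
    have b1: "b1 \<in> UNIV \<rightarrow> carrier_vec (n1 - 1)"
      by (simp add: b1_def)
    have "equilibrium_branch n1 (admissible g h W1) s (\<lambda>l. b1 l @\<^sub>v vec1 (bc l))"
      unfolding equilibrium_branch_iff
    proof (intro conjI allI impI)
      fix i assume i: "i < n1"
      \<comment> \<open>\<open>bc\<close> is 0 only near parameter 0, so the last component is kept
        as \<open>bc\<close> and its germ continuity is used.\<close>
      have "(\<lambda>l. (b1 l @\<^sub>v vec1 (bc l)) $ i) = (if i = n1 - 1 then bc else (\<lambda>l. 0))"
        using i by (auto simp: b1_def)
      then show "germ_continuous s (\<lambda>l. (b1 l @\<^sub>v vec1 (bc l)) $ i)"
        using bc(1) by (simp add: germ_continuous_const)
    next
      show "b1 0 @\<^sub>v vec1 (bc 0) = 0\<^sub>v n1"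
        using bc(2) by (simp add: b1_def zero_vec_append_vec1[OF car(3)] del: One_nat_def)
      show "\<forall>\<^sub>F l in germ_filter s. b1 l @\<^sub>v vec1 (bc l) \<in> carrier_vec n1 \<and>
          admissible g h W1 (b1 l @\<^sub>v vec1 (bc l)) l = 0\<^sub>v n1"
        using bc0 by eventually_elim
          (simp add: b1_def zero_vec_append_vec1[OF car(3), symmetric] admissible_0[OF car(1)]
            del: One_nat_def)
    qed
    with b t have "bifurcation_branch (n1 + n2 - 1) (admissible g h (coalescence W1 W2)) s
        (\<lambda>l. b1 l @\<^sub>v vec1 (bc l) @\<^sub>v b2 l)"
      unfolding bifurcation_branch_def equilibrium_branch_coalescence_iff[OF b1 b2]
        germ_eq_append3_iff[OF b1] germ_eq_vec1_append_iff by blast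
    moreover have "germ_eq s b1' b1" if b1': "b1' \<in> UNIV \<rightarrow> carrier_vec (n1 - 1)"
      and "bifurcation_branch (n1 + n2 - 1) (admissible g h (coalescence W1 W2)) s
               (\<lambda>l. b1' l @\<^sub>v vec1 (bc l) @\<^sub>v b2 l)" for b1'
      using zero[OF b1'] that(2) unfolding b1_def bifurcation_branch_def
        equilibrium_branch_coalescence_iff[OF b1' b2] by blast
    ultimately show "\<exists>b1 \<in> UNIV \<rightarrow> carrier_vec (n1 - 1).
        bifurcation_branch (n1 + n2 - 1) (admissible g h (coalescence W1 W2)) s
          (\<lambda>l. b1 l @\<^sub>v vec1 (bc l) @\<^sub>v b2 l) \<and>
        (\<forall>b1' \<in> UNIV \<rightarrow> carrier_vec (n1 - 1).
           bifurcation_branch (n1 + n2 - 1) (admissible g h (coalescence W1 W2)) s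
             (\<lambda>l. b1' l @\<^sub>v vec1 (bc l) @\<^sub>v b2 l) \<longrightarrow> germ_eq s b1' b1)"
      using b1 by blast
  next
    assume b1: "b1 \<in> UNIV \<rightarrow> carrier_vec (n1 - 1)"
      and b: "bifurcation_branch (n1 + n2 - 1) (admissible g h (coalescence W1 W2)) s
          (\<lambda>l. b1 l @\<^sub>v vec1 (bc l) @\<^sub>v b2 l)"
    then have e1: "equilibrium_branch n1 (admissible g h W1) s (\<lambda>l. b1 l @\<^sub>v vec1 (bc l))"
      and t: "tail_branch g h W2 n2 s bc b2"
      unfolding bifurcation_branch_def equilibrium_branch_coalescence_iff[OF b1 b2] by blast+
    note z = zero[OF b1 e1]
    \<comment> \<open>This is the equation of the second network at \<open>c\<close>, which the
      coalescence does not contain; it holds because \<open>bc\<close> is 0 as a germ.\<close>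
    have "\<forall>\<^sub>F l in germ_filter s. g (bc l, l) = 0"
      using z[THEN conjunct2] unfolding germ_eq_iff_eventually
      by eventually_elim (simp add: g_0)
    then have "equilibrium_branch n2 (admissible g h W2) s (\<lambda>l. vec1 (bc l) @\<^sub>v b2 l)"
      using t equilibrium_branch_fst_last[OF b1 e1] equilibrium_branch_snd_iff[OF b2] by blast
    then show "bifurcation_branch n2 (admissible g h W2) s (\<lambda>l. vec1 (bc l) @\<^sub>v b2 l)"
      using b z unfolding bifurcation_branch_def germ_eq_append3_iff[OF b1]
        germ_eq_vec1_append_iff by blast
  }
qed

end

theorem proposition3p12:
  fixes g :: "real \<times> real \<Rightarrow> real"
    and h :: "real \<times> real \<times> real \<Rightarrow> real"
    and W1 W2 :: "real mat"
    and n1 n2 :: nat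
    and \<mu> :: complex
  assumes "feedforward_coalescence n1 n2 W1 W2"
    and "smooth g" and "smooth h"
    and "diffusive h"
    and "\<And>l. g (0, l) = 0"
    and "bifurcation_condition g h (coalescence W1 W2) \<mu>"
    and "generic_condition g h (coalescence W1 W2) \<mu>"
  shows
    "(bifurcation_condition g h W1 \<mu> \<and> \<not> bifurcation_condition g h W2 \<mu> \<longrightarrow>
       (\<forall>s. \<forall>b1 \<in> UNIV \<rightarrow> carrier_vec (n1 - 1). \<forall>bc.
          bifurcation_branch n1 (admissible g h W1) s (\<lambda>l. b1 l @\<^sub>v vec1 (bc l)) \<longrightarrow>
          (\<exists>b2 \<in> UNIV \<rightarrow> carrier_vec (n2 - 1).
             bifurcation_branch (n1 + n2 - 1) (admissible g h (coalescence W1 W2)) s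
               (\<lambda>l. b1 l @\<^sub>v vec1 (bc l) @\<^sub>v b2 l) \<and>
             (\<forall>b2' \<in> UNIV \<rightarrow> carrier_vec (n2 - 1).
                bifurcation_branch (n1 + n2 - 1) (admissible g h (coalescence W1 W2)) s
                  (\<lambda>l. b1 l @\<^sub>v vec1 (bc l) @\<^sub>v b2' l) \<longrightarrow> germ_eq s b2' b2))) \<and>
       (\<forall>s. \<forall>b1 \<in> UNIV \<rightarrow> carrier_vec (n1 - 1). \<forall>bc. \<forall>b2 \<in> UNIV \<rightarrow> carrier_vec (n2 - 1).
          bifurcation_branch (n1 + n2 - 1) (admissible g h (coalescence W1 W2)) s
            (\<lambda>l. b1 l @\<^sub>v vec1 (bc l) @\<^sub>v b2 l) \<longrightarrow>
          bifurcation_branch n1 (admissible g h W1) s (\<lambda>l. b1 l @\<^sub>v vec1 (bc l))))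
     \<and>
     (bifurcation_condition g h W2 \<mu> \<and> \<not> bifurcation_condition g h W1 \<mu> \<longrightarrow>
       (\<forall>s. \<forall>bc. \<forall>b2 \<in> UNIV \<rightarrow> carrier_vec (n2 - 1).
          bifurcation_branch n2 (admissible g h W2) s (\<lambda>l. vec1 (bc l) @\<^sub>v b2 l) \<longrightarrow>
          (\<exists>b1 \<in> UNIV \<rightarrow> carrier_vec (n1 - 1).
             bifurcation_branch (n1 + n2 - 1) (admissible g h (coalescence W1 W2)) s
               (\<lambda>l. b1 l @\<^sub>v vec1 (bc l) @\<^sub>v b2 l) \<and>
             (\<forall>b1' \<in> UNIV \<rightarrow> carrier_vec (n1 - 1).
                bifurcation_branch (n1 + n2 - 1) (admissible g h (coalescence W1 W2)) s
                  (\<lambda>l. b1' l @\<^sub>v vec1 (bc l) @\<^sub>v b2 l) \<longrightarrow> germ_eq s b1' b1))) \<and>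
       (\<forall>s. \<forall>b1 \<in> UNIV \<rightarrow> carrier_vec (n1 - 1). \<forall>bc. \<forall>b2 \<in> UNIV \<rightarrow> carrier_vec (n2 - 1).
          bifurcation_branch (n1 + n2 - 1) (admissible g h (coalescence W1 W2)) s
            (\<lambda>l. b1 l @\<^sub>v vec1 (bc l) @\<^sub>v b2 l) \<longrightarrow>
          bifurcation_branch n2 (admissible g h W2) s (\<lambda>l. vec1 (bc l) @\<^sub>v b2 l)))"
proof -
  interpret feedforward_system g h W1 W2 n1 n2
    using assms(1-5) by unfold_locales
  have N: "coalescence W1 W2 \<in> carrier_mat (n1 + n2 - 1) (n1 + n2 - 1)" "n1 + n2 - 1 > 0"
    using coalescence_carrier[OF car(1,2)] car(3,4) by auto
  \<comment> \<open>In each part this is applied to the factor for which the condition fails; it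
    provides the non-zero derivatives and the nonsingular Jacobian of that factor.\<close>
  note off = bifurcation_condition_off_factor[OF assms(6,7) N]
  show ?thesis
  proof (rule conjI; rule impI; elim conjE)
    assume "\<not> bifurcation_condition g h W2 \<mu>"
    note off2 = off[OF car(2,4) this]
    note bif = bifurcation_fst[OF off2(2,1,3)]
    show "(\<forall>s. \<forall>b1 \<in> UNIV \<rightarrow> carrier_vec (n1 - 1). \<forall>bc.
          bifurcation_branch n1 (admissible g h W1) s (\<lambda>l. b1 l @\<^sub>v vec1 (bc l)) \<longrightarrow>
          (\<exists>b2 \<in> UNIV \<rightarrow> carrier_vec (n2 - 1).
             bifurcation_branch (n1 + n2 - 1) (admissible g h (coalescence W1 W2)) s
               (\<lambda>l. b1 l @\<^sub>v vec1 (bc l) @\<^sub>v b2 l) \<and>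
             (\<forall>b2' \<in> UNIV \<rightarrow> carrier_vec (n2 - 1).
                bifurcation_branch (n1 + n2 - 1) (admissible g h (coalescence W1 W2)) s
                  (\<lambda>l. b1 l @\<^sub>v vec1 (bc l) @\<^sub>v b2' l) \<longrightarrow> germ_eq s b2' b2))) \<and>
       (\<forall>s. \<forall>b1 \<in> UNIV \<rightarrow> carrier_vec (n1 - 1). \<forall>bc. \<forall>b2 \<in> UNIV \<rightarrow> carrier_vec (n2 - 1).
          bifurcation_branch (n1 + n2 - 1) (admissible g h (coalescence W1 W2)) s
            (\<lambda>l. b1 l @\<^sub>v vec1 (bc l) @\<^sub>v b2 l) \<longrightarrow>
          bifurcation_branch n1 (admissible g h W1) s (\<lambda>l. b1 l @\<^sub>v vec1 (bc l)))"
      by (intro conjI allI ballI impI) (rule bif; assumption)+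
  next
    assume "\<not> bifurcation_condition g h W1 \<mu>"
    note off1 = off[OF car(1,3) this]
    note bif = bifurcation_snd[OF off1(2,1,3)]
    show "(\<forall>s. \<forall>bc. \<forall>b2 \<in> UNIV \<rightarrow> carrier_vec (n2 - 1).
          bifurcation_branch n2 (admissible g h W2) s (\<lambda>l. vec1 (bc l) @\<^sub>v b2 l) \<longrightarrow>
          (\<exists>b1 \<in> UNIV \<rightarrow> carrier_vec (n1 - 1).
             bifurcation_branch (n1 + n2 - 1) (admissible g h (coalescence W1 W2)) s
               (\<lambda>l. b1 l @\<^sub>v vec1 (bc l) @\<^sub>v b2 l) \<and>
             (\<forall>b1' \<in> UNIV \<rightarrow> carrier_vec (n1 - 1).
                bifurcation_branch (n1 + n2 - 1) (admissible g h (coalescence W1 W2)) s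
                  (\<lambda>l. b1' l @\<^sub>v vec1 (bc l) @\<^sub>v b2 l) \<longrightarrow> germ_eq s b1' b1))) \<and>
       (\<forall>s. \<forall>b1 \<in> UNIV \<rightarrow> carrier_vec (n1 - 1). \<forall>bc. \<forall>b2 \<in> UNIV \<rightarrow> carrier_vec (n2 - 1).
          bifurcation_branch (n1 + n2 - 1) (admissible g h (coalescence W1 W2)) s
            (\<lambda>l. b1 l @\<^sub>v vec1 (bc l) @\<^sub>v b2 l) \<longrightarrow>
          bifurcation_branch n2 (admissible g h W2) s (\<lambda>l. vec1 (bc l) @\<^sub>v b2 l))"
      by (intro conjI allI ballI impI) (rule bif; assumption)+
  qed
qed

end
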